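(* Suppose $\mathscr{V}=\mathsf{Set}$. For a class $\mathbb{D}$ of small categories, the following conditions are equivalent: (1) The class $\Psi_{\mathbb{D}}$ of conical weights $\mathsf{const}_1:\mathscr{D}^{op}\to\mathsf{Set}$ with $\mathscr{D}^{op}$ in $\mathbb{D}$ is sound. (2) A (small) category $\mathscr{E}$ is $\mathbb{D}$-filtered whenever, for every functor $T:\mathscr{D}\to\mathscr{E}$ with $\mathscr{D}^{op}$ in $\mathbb{D}$, the category of cocones for $T$ is nonempty and connected.
   Context: Here everything is enriched in $\mathsf{Set}$ (ordinary categories). A weight is a functor $\varphi:\mathscr{E}^{op}\to\mathsf{Set}$ with $\mathscr{E}$ small. The colimit $\varphi\star D$ of $D:\mathscr{E}\to\mathscr{K}$ weighted by $\varphi$ is defined by $\mathscr{K}(\varphi\star D,X)\cong[\mathscr{E}^{op},\mathsf{Set}](\varphi,\mathscr{K}(D-,X))$, naturally in $X$. The limit $\{\varphi,D\}$ of $D:\mathscr{E}^{op}\to\mathscr{K}$ weighted by $\varphi$ is defined by $\mathscr{K}(X,\{\varphi,D\})\cong[\mathscr{E}^{op},\mathsf{Set}](\varphi,\mathscr{K}(X,D-))$, naturally in $X$. The conical weight $\mathsf{const}_1:\mathscr{D}^{op}\to\mathsf{Set}$ is the functor constant at the one-element set; (co)limits weighted by it are ordinary (co)limits. For a class $\Psi$ of weights, a $\Psi$-limit is a limit weighted by a weight in $\Psi$. A weight $\varphi:\mathscr{E}^{op}\to\mathsf{Set}$ is $\Psi$-flat if $\varphi\star(-):[\mathscr{E},\mathsf{Set}]\to\mathsf{Set}$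 preserves $\Psi$-limits. The class $\Psi$ is sound if a weight $\varphi:\mathscr{E}^{op}\to\mathsf{Set}$ is $\Psi$-flat whenever $\varphi\star(-):[\mathscr{E},\mathsf{Set}]\to\mathsf{Set}$ preserves $\Psi$-limits of representables, i.e., whenever for every $\psi:\mathscr{D}^{op}\to\mathsf{Set}$ in $\Psi$ and every $T:\mathscr{D}\to\mathscr{E}$ the canonical morphism $\varphi\star\{\psi,YT^{op}-\}\to\{\psi,\varphi\cdot T^{op}\}$ is an isomorphism, where $Y:\mathscr{E}^{op}\to[\mathscr{E},\mathsf{Set}]$ is the Yoneda embedding. A small category $\mathscr{E}$ is $\mathbb{D}$-filtered if colimits over $\mathscr{E}$ commute in $\mathsf{Set}$ with limits over categories in $\mathbb{D}$; equivalently, if the conical weight $\mathsf{const}_1:\mathscr{E}^{op}\to\mathsf{Set}$ is $\Psi_{\mathbb{D}}$-flat. The category of cocones for $T:\mathscr{D}\to\mathscr{E}$ has as objects the pairs of an object $e$ of $\mathscr{E}$ and a cocone from $T$ to $e$, and as morphisms the morphisms of $\mathscr{E}$ between the vertices that commute with the cocones. Connected means that any two objects are joined by a zig-zag of morphisms. *)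

theory Defs
  imports "HOL-Library.FuncSet" "HOL-Library.Equipollence"
begin

section \<open>Universes and smallness\<close>

text \<open>
  A type plays the role of a Grothendieck universe: the small sets are those of cardinality
  strictly less than that of the type, which is required to be infinite, regular and a strong
  limit. Hence, up to bijection, the small sets are the elements of \<open>V\<^sub>\<kappa>\<close>, with \<open>\<kappa>\<close> the
  cardinality of the type. Uncountability is not imposed, so \<open>V\<^sub>\<omega>\<close> is admitted as well.
\<close>

definition small :: "'u set \<Rightarrow> bool" where
  "small A \<longleftrightarrow> A \<prec> (UNIV :: 'u set)"

class universe =
  assumes infinite_universe: "infinite (UNIV :: 'a set)"
    and strong_limit: "small (A :: 'a set) \<Longrightarrow> Pow A \<prec> (UNIV :: 'a set)"
    and regular: "small (A :: 'a set) \<Longrightarrow> (\<And>a. a \<in> A \<Longrightarrow> small (f a :: 'a set)) \<Longrightarrow> small (\<Union>a\<in>A. f a)"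


section \<open>Categories and functors\<close>

text \<open>
  \<open>Hom C x y\<close> is only meaningful for objects \<open>x\<close>, \<open>y\<close>, and hom-sets need not be disjoint;
  accordingly composition, and the action of a functor on arrows, take the objects involved as
  arguments. \<open>Comp C x y z g f\<close> is the composite of \<open>f : x \<rightarrow> y\<close> and \<open>g : y \<rightarrow> z\<close>.
\<close>

record ('o, 'a) cat =
  Obj :: "'o set"
  Hom :: "'o \<Rightarrow> 'o \<Rightarrow> 'a set"
  Ident :: "'o \<Rightarrow> 'a"
  Comp :: "'o \<Rightarrow> 'o \<Rightarrow> 'o \<Rightarrow> 'a \<Rightarrow> 'a \<Rightarrow> 'a"

definition is_category :: "('o, 'a) cat \<Rightarrow> bool" where
  "is_category C \<longleftrightarrow>
    (\<forall>x\<in>Obj C. Ident C x \<in> Hom C x x) \<and>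
    (\<forall>x\<in>Obj C. \<forall>y\<in>Obj C. \<forall>z\<in>Obj C. \<forall>f\<in>Hom C x y. \<forall>g\<in>Hom C y z. Comp C x y z g f \<in> Hom C x z) \<and>
    (\<forall>x\<in>Obj C. \<forall>y\<in>Obj C. \<forall>f\<in>Hom C x y.
       Comp C x x y f (Ident C x) = f \<and> Comp C x y y (Ident C y) f = f) \<and>
    (\<forall>w\<in>Obj C. \<forall>x\<in>Obj C. \<forall>y\<in>Obj C. \<forall>z\<in>Obj C.
       \<forall>f\<in>Hom C w x. \<forall>g\<in>Hom C x y. \<forall>h\<in>Hom C y z.
         Comp C w y z h (Comp C w x y g f) = Comp C w x z (Comp C x y z h g) f)"

definition small_category :: "('u, 'u) cat \<Rightarrow> bool" where
  "small_category C \<longleftrightarrow>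
    is_category C \<and> small (Obj C) \<and> (\<forall>x\<in>Obj C. \<forall>y\<in>Obj C. small (Hom C x y))"

definition op_cat :: "('o, 'a) cat \<Rightarrow> ('o, 'a) cat" where
  "op_cat C = \<lparr> Obj = Obj C, Hom = (\<lambda>x y. Hom C y x), Ident = Ident C,
                Comp = (\<lambda>x y z g f. Comp C z y x f g) \<rparr>"

record ('o, 'p, 'a, 'b) fctr =
  omap :: "'o \<Rightarrow> 'p"
  amap :: "'o \<Rightarrow> 'o \<Rightarrow> 'a \<Rightarrow> 'b"

definition is_functor :: "('o, 'a) cat \<Rightarrow> ('p, 'b) cat \<Rightarrow> ('o, 'p, 'a, 'b) fctr \<Rightarrow> bool" where
  "is_functor C K F \<longleftrightarrow>
    (\<forall>x\<in>Obj C. omap F x \<in> Obj K) \<and>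
    (\<forall>x\<in>Obj C. \<forall>y\<in>Obj C. \<forall>f\<in>Hom C x y. amap F x y f \<in> Hom K (omap F x) (omap F y)) \<and>
    (\<forall>x\<in>Obj C. amap F x x (Ident C x) = Ident K (omap F x)) \<and>
    (\<forall>x\<in>Obj C. \<forall>y\<in>Obj C. \<forall>z\<in>Obj C. \<forall>f\<in>Hom C x y. \<forall>g\<in>Hom C y z.
       amap F x z (Comp C x y z g f) =
       Comp K (omap F x) (omap F y) (omap F z) (amap F y z g) (amap F x y f))"

definition comp_fctr ::
    "('p, 'q, 'b, 'c) fctr \<Rightarrow> ('o, 'p, 'a, 'b) fctr \<Rightarrow> ('o, 'q, 'a, 'c) fctr" where
  "comp_fctr G F = \<lparr> omap = (\<lambda>x. omap G (omap F x)),
                     amap = (\<lambda>x y f. amap G (omap F x) (omap F y) (amap F x y f)) \<rparr>"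

definition op_fctr :: "('o, 'p, 'a, 'b) fctr \<Rightarrow> ('o, 'p, 'a, 'b) fctr" where
  "op_fctr F = \<lparr> omap = omap F, amap = (\<lambda>x y. amap F y x) \<rparr>"

definition SET :: "('u set, 'u \<Rightarrow> 'u) cat" where
  "SET = \<lparr> Obj = {A. small A}, Hom = (\<lambda>A B. A \<rightarrow>\<^sub>E B), Ident = (\<lambda>A. \<lambda>x\<in>A. x),
           Comp = (\<lambda>A B C g f. compose A g f) \<rparr>"

text \<open>
  Two functors that differ only outside \<open>C\<close> are different objects of \<open>[C, K]\<close>, but
  isomorphic ones (via identities); natural transformations are extensional, so hom-sets are exact.
\<close>

definition fun_cat ::
    "('o, 'a) cat \<Rightarrow> ('p, 'b) cat \<Rightarrow> (('o, 'p, 'a, 'b) fctr, 'o \<Rightarrow> 'b) cat" where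
  "fun_cat C K =
    \<lparr> Obj = {F. is_functor C K F},
      Hom = (\<lambda>F G. {\<tau> \<in> (\<Pi>\<^sub>E x\<in>Obj C. Hom K (omap F x) (omap G x)).
        \<forall>x\<in>Obj C. \<forall>y\<in>Obj C. \<forall>f\<in>Hom C x y.
          Comp K (omap F x) (omap F y) (omap G y) (\<tau> y) (amap F x y f) =
          Comp K (omap F x) (omap G x) (omap G y) (amap G x y f) (\<tau> x)}),
      Ident = (\<lambda>F. \<lambda>x\<in>Obj C. Ident K (omap F x)),
      Comp = (\<lambda>F G H \<tau> \<sigma>. \<lambda>x\<in>Obj C. Comp K (omap F x) (omap G x) (omap H x) (\<tau> x) (\<sigma> x)) \<rparr>"

text \<open>The Yoneda embedding \<open>E\<^sup>o\<^sup>p \<rightarrow> [E, Set]\<close>.\<close>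

definition yoneda ::
    "('u, 'u) cat \<Rightarrow> ('u, ('u, 'u set, 'u, 'u \<Rightarrow> 'u) fctr, 'u, 'u \<Rightarrow> 'u \<Rightarrow> 'u) fctr" where
  "yoneda E =
    \<lparr> omap = (\<lambda>e. \<lparr> omap = (\<lambda>x. Hom E e x),
                     amap = (\<lambda>x y f. \<lambda>h\<in>Hom E e x. Comp E e x y f h) \<rparr>),
      amap = (\<lambda>e e' k. \<lambda>x\<in>Obj E. \<lambda>h\<in>Hom E e x. Comp E e' e x h k) \<rparr>"


section \<open>Weighted limits and colimits\<close>

text \<open>
  \<open>set_nat C P Q\<close> is the set of natural transformations between set-valued functors \<open>P\<close> and \<open>Q\<close>
  on \<open>C\<close>. The values of \<open>P\<close> and \<open>Q\<close> may be sets over different types, since the hom-sets of the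
  ambient category \<open>K\<close> below are not sets over the universe type when \<open>K = [E, Set]\<close>.
\<close>

definition set_nat ::
    "('o, 'a) cat \<Rightarrow> ('o, 'v set, 'a, 'v \<Rightarrow> 'v) fctr \<Rightarrow> ('o, 'w set, 'a, 'w \<Rightarrow> 'w) fctr
      \<Rightarrow> ('o \<Rightarrow> 'v \<Rightarrow> 'w) set" where
  "set_nat C P Q =
    {\<alpha> \<in> (\<Pi>\<^sub>E x\<in>Obj C. omap P x \<rightarrow>\<^sub>E omap Q x).
      \<forall>x\<in>Obj C. \<forall>y\<in>Obj C. \<forall>f\<in>Hom C x y. \<forall>p\<in>omap P x.
        \<alpha> y (amap P x y f p) = amap Q x y f (\<alpha> x p)}"

text \<open>The functors \<open>K(X, D-) : C \<rightarrow> Set\<close> and \<open>K(D-, X) : C\<^sup>o\<^sup>p \<rightarrow> Set\<close> for \<open>D : C \<rightarrow> K\<close>.\<close>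

definition hom_from ::
    "('p, 'b) cat \<Rightarrow> 'p \<Rightarrow> ('o, 'p, 'a, 'b) fctr \<Rightarrow> ('o, 'b set, 'a, 'b \<Rightarrow> 'b) fctr" where
  "hom_from K X D =
    \<lparr> omap = (\<lambda>c. Hom K X (omap D c)),
      amap = (\<lambda>c d f. \<lambda>h\<in>Hom K X (omap D c). Comp K X (omap D c) (omap D d) (amap D c d f) h) \<rparr>"

definition hom_to ::
    "('p, 'b) cat \<Rightarrow> ('o, 'p, 'a, 'b) fctr \<Rightarrow> 'p \<Rightarrow> ('o, 'b set, 'a, 'b \<Rightarrow> 'b) fctr" where
  "hom_to K D X =
    \<lparr> omap = (\<lambda>c. Hom K (omap D c) X),
      amap = (\<lambda>c d f. \<lambda>h\<in>Hom K (omap D c) X. Comp K (omap D d) (omap D c) X h (amap D d c f)) \<rparr>"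

text \<open>
  \<open>L\<close> is the limit of \<open>D : E\<^sup>o\<^sup>p \<rightarrow> K\<close> weighted by \<open>\<phi> : E\<^sup>o\<^sup>p \<rightarrow> Set\<close>, with unit
  \<open>\<lambda> : \<phi> \<rightarrow> K(L, D-)\<close>. A bijection \<open>K(X, L) \<cong> [E\<^sup>o\<^sup>p, Set](\<phi>, K(X, D-))\<close> natural in \<open>X\<close>
  is, by naturality, of the form \<open>h \<mapsto> K(h, D-) \<circ> \<lambda>\<close> with \<open>\<lambda>\<close> the image of the identity of \<open>L\<close>;
  this is how the natural bijection is given here. Dually for colimits.
\<close>

definition is_wlim ::
    "('p, 'b) cat \<Rightarrow> ('o, 'a) cat \<Rightarrow> ('o, 'v set, 'a, 'v \<Rightarrow> 'v) fctr \<Rightarrow> ('o, 'p, 'a, 'b) fctr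
      \<Rightarrow> 'p \<Rightarrow> ('o \<Rightarrow> 'v \<Rightarrow> 'b) \<Rightarrow> bool" where
  "is_wlim K E \<phi> D L l \<longleftrightarrow>
    L \<in> Obj K \<and> l \<in> set_nat (op_cat E) \<phi> (hom_from K L D) \<and>
    (\<forall>X\<in>Obj K. bij_betw
      (\<lambda>h. \<lambda>e\<in>Obj E. \<lambda>p\<in>omap \<phi> e. Comp K X L (omap D e) (l e p) h)
      (Hom K X L) (set_nat (op_cat E) \<phi> (hom_from K X D)))"

definition is_wcolim ::
    "('p, 'b) cat \<Rightarrow> ('o, 'a) cat \<Rightarrow> ('o, 'v set, 'a, 'v \<Rightarrow> 'v) fctr \<Rightarrow> ('o, 'p, 'a, 'b) fctr
      \<Rightarrow> 'p \<Rightarrow> ('o \<Rightarrow> 'v \<Rightarrow> 'b) \<Rightarrow> bool" where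
  "is_wcolim K E \<phi> D Q q \<longleftrightarrow>
    Q \<in> Obj K \<and> q \<in> set_nat (op_cat E) \<phi> (hom_to K D Q) \<and>
    (\<forall>X\<in>Obj K. bij_betw
      (\<lambda>h. \<lambda>e\<in>Obj E. \<lambda>p\<in>omap \<phi> e. Comp K (omap D e) Q X h (q e p))
      (Hom K Q X) (set_nat (op_cat E) \<phi> (hom_to K D X)))"

text \<open>The functor \<open>\<phi> \<star> (-) : [E, Set] \<rightarrow> Set\<close>, for a choice of weighted colimits.\<close>

definition star_colim ::
    "('u, 'u) cat \<Rightarrow> ('u, 'u set, 'u, 'u \<Rightarrow> 'u) fctr \<Rightarrow> ('u, 'u set, 'u, 'u \<Rightarrow> 'u) fctr
      \<Rightarrow> 'u set \<times> ('u \<Rightarrow> 'u \<Rightarrow> 'u \<Rightarrow> 'u)" where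
  "star_colim E \<phi> F = (SOME (Q, q). is_wcolim SET E \<phi> F Q q)"

definition star ::
    "('u, 'u) cat \<Rightarrow> ('u, 'u set, 'u, 'u \<Rightarrow> 'u) fctr
      \<Rightarrow> (('u, 'u set, 'u, 'u \<Rightarrow> 'u) fctr, 'u set, 'u \<Rightarrow> 'u \<Rightarrow> 'u, 'u \<Rightarrow> 'u) fctr" where
  "star E \<phi> =
    \<lparr> omap = (\<lambda>F. fst (star_colim E \<phi> F)),
      amap = (\<lambda>F G \<tau>. THE h. h \<in> Hom SET (fst (star_colim E \<phi> F)) (fst (star_colim E \<phi> G)) \<and>
        (\<forall>e\<in>Obj E. \<forall>p\<in>omap \<phi> e.
          Comp SET (omap F e) (fst (star_colim E \<phi> F)) (fst (star_colim E \<phi> G))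
            h (snd (star_colim E \<phi> F) e p) =
          Comp SET (omap F e) (omap G e) (fst (star_colim E \<phi> G))
            (snd (star_colim E \<phi> G) e p) (\<tau> e))) \<rparr>"

text \<open>\<open>G : K \<rightarrow> K'\<close> preserves limits of \<open>S : D\<^sup>o\<^sup>p \<rightarrow> K\<close> weighted by \<open>\<psi> : D\<^sup>o\<^sup>p \<rightarrow> Set\<close>.\<close>

definition preserves_wlim ::
    "('p, 'b) cat \<Rightarrow> ('q, 'c) cat \<Rightarrow> ('p, 'q, 'b, 'c) fctr
      \<Rightarrow> ('o, 'a) cat \<Rightarrow> ('o, 'v set, 'a, 'v \<Rightarrow> 'v) fctr \<Rightarrow> ('o, 'p, 'a, 'b) fctr \<Rightarrow> bool" where
  "preserves_wlim K K' G D \<psi> S \<longleftrightarrow>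
    (\<forall>L l. is_wlim K D \<psi> S L l \<longrightarrow>
      is_wlim K' D \<psi> (comp_fctr G S) (omap G L)
        (\<lambda>d\<in>Obj D. \<lambda>p\<in>omap \<psi> d. amap G L (omap S d) (l d p)))"


section \<open>Flatness, soundness and filteredness\<close>

text \<open>A weight \<open>\<phi> : E\<^sup>o\<^sup>p \<rightarrow> Set\<close> is represented by the pair \<open>(E, \<phi>)\<close>.\<close>

type_synonym 'u weight = "('u, 'u) cat \<times> ('u, 'u set, 'u, 'u \<Rightarrow> 'u) fctr"

definition is_weight :: "'u weight \<Rightarrow> bool" where
  "is_weight w \<longleftrightarrow> small_category (fst w) \<and> is_functor (op_cat (fst w)) SET (snd w)"

definition flat :: "'u weight set \<Rightarrow> 'u weight \<Rightarrow> bool" where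
  "flat \<Psi> = (\<lambda>(E, \<phi>). \<forall>(D, \<psi>)\<in>\<Psi>. \<forall>S. is_functor (op_cat D) (fun_cat E SET) S \<longrightarrow>
     preserves_wlim (fun_cat E SET) SET (star E \<phi>) D \<psi> S)"

definition flat_on_representables :: "'u weight set \<Rightarrow> 'u weight \<Rightarrow> bool" where
  "flat_on_representables \<Psi> = (\<lambda>(E, \<phi>). \<forall>(D, \<psi>)\<in>\<Psi>. \<forall>T. is_functor D E T \<longrightarrow>
     preserves_wlim (fun_cat E SET) SET (star E \<phi>) D \<psi> (comp_fctr (yoneda E) (op_fctr T)))"

definition sound :: "'u weight set \<Rightarrow> bool" where
  "sound \<Psi> \<longleftrightarrow> (\<forall>w. is_weight w \<longrightarrow> flat_on_representables \<Psi> w \<longrightarrow> flat \<Psi> w)"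

text \<open>The functor \<open>const\<^sub>1\<close>; its value is a singleton, here \<open>{undefined}\<close>.\<close>

definition const1 :: "('u, 'u set, 'u, 'u \<Rightarrow> 'u) fctr" where
  "const1 = \<lparr> omap = (\<lambda>_. {undefined}), amap = (\<lambda>_ _ _. \<lambda>x\<in>{undefined}. x) \<rparr>"

definition conical_weights :: "('u, 'u) cat set \<Rightarrow> 'u weight set" where
  "conical_weights DD = {(D, const1) | D. op_cat D \<in> DD}"

text \<open>
  Colimits over \<open>E\<close> commute in \<open>Set\<close> with limits over the categories \<open>C\<close> in the class, that is,
  \<open>colim\<^sub>E : [E, Set] \<rightarrow> Set\<close> preserves limits over \<open>C\<close>. Ordinary (co)limits are those weighted by
  \<open>const\<^sub>1\<close>; a limit over \<open>C\<close> is weighted by \<open>const\<^sub>1 : (C\<^sup>o\<^sup>p)\<^sup>o\<^sup>p \<rightarrow> Set\<close>.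
\<close>

definition filtered :: "('u, 'u) cat set \<Rightarrow> ('u, 'u) cat \<Rightarrow> bool" where
  "filtered DD E \<longleftrightarrow> (\<forall>C\<in>DD. \<forall>S. is_functor C (fun_cat E SET) S \<longrightarrow>
     preserves_wlim (fun_cat E SET) SET (star E const1) (op_cat C) const1 S)"

lemma op_op_cat [simp]: "op_cat (op_cat C) = (C :: ('o, 'a) cat)"
  by (simp add: op_cat_def)

lemma filtered_iff_flat: "filtered DD E \<longleftrightarrow> flat (conical_weights DD) (E, const1)"
  unfolding filtered_def flat_def conical_weights_def by (auto; metis op_op_cat)


section \<open>Cocones\<close>

definition cocone_cat ::
    "('o, 'a) cat \<Rightarrow> ('p, 'b) cat \<Rightarrow> ('o, 'p, 'a, 'b) fctr \<Rightarrow> ('p \<times> ('o \<Rightarrow> 'b), 'b) cat" where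
  "cocone_cat D E T =
    \<lparr> Obj = {(e, c). e \<in> Obj E \<and> c \<in> (\<Pi>\<^sub>E d\<in>Obj D. Hom E (omap T d) e) \<and>
        (\<forall>d\<in>Obj D. \<forall>d'\<in>Obj D. \<forall>f\<in>Hom D d d'.
          Comp E (omap T d) (omap T d') e (c d') (amap T d d' f) = c d)},
      Hom = (\<lambda>(e, c) (e', c').
        {h \<in> Hom E e e'. \<forall>d\<in>Obj D. Comp E (omap T d) e e' h (c d) = c' d}),
      Ident = (\<lambda>(e, _). Ident E e),
      Comp = (\<lambda>(e, _) (e', _) (e'', _). Comp E e e' e'') \<rparr>"

definition nonempty_cat :: "('o, 'a) cat \<Rightarrow> bool" where
  "nonempty_cat C \<longleftrightarrow> Obj C \<noteq> {}"

definition connected_cat :: "('o, 'a) cat \<Rightarrow> bool" where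
  "connected_cat C \<longleftrightarrow> (\<forall>x\<in>Obj C. \<forall>y\<in>Obj C.
     (x, y) \<in> {(a, b). a \<in> Obj C \<and> b \<in> Obj C \<and> (Hom C a b \<noteq> {} \<or> Hom C b a \<noteq> {})}\<^sup>*)"

end

theory Submission
  imports Defs
begin

text \<open>
  Both implications rest on a computation of the comparison map at limits of representables. Let \<open>\<phi>\<close>
  be a weight on \<open>E\<close> and \<open>T : D \<rightarrow> E\<close>. The limit of the representables \<open>E(T d, -)\<close> is the functor that
  sends \<open>e\<close> to the set of cocones from \<open>T\<close> to \<open>e\<close>. A colimit of sets is a set of connected
  components, so \<open>\<phi> \<star> (-)\<close> sends this functor to the components of the category of triples
  \<open>(e, p, c)\<close> with \<open>p\<close> in \<open>\<phi> e\<close> and \<open>c\<close> a cocone from \<open>T\<close> to \<open>e\<close>. By the co-Yoneda lemma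
  \<open>\<phi> \<star> E(T d, -)\<close> is \<open>\<phi>(T d)\<close>, and a point of the limit of these sets is the same thing as a lift
  \<open>T'\<close> of \<open>T\<close> to the category of elements of \<open>\<phi>\<close>. The fibre of the comparison map over \<open>T'\<close> is the
  set of components of the category of cocones for \<open>T'\<close>. Hence \<open>\<phi> \<star> (-)\<close> preserves these limits of
  representables exactly if the category of cocones is nonempty and connected for every functor
  from \<open>D\<close> to the category of elements.

  For the conical weight the category of elements is \<open>E\<close> itself, so a category with nonempty
  and connected categories of cocones has a conical weight that is flat on representables, and
  soundness makes it filtered (\<open>connected_cocones_preserves_representables\<close>). Conversely, if \<open>\<phi>\<close> is
  flat on representables, then its category of elements has nonempty and connected categories of
  cocones (\<open>preserves_representables_imp_connected_cocones\<close>), so it is filtered by the second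
  condition. Since \<open>\<phi> \<star> F\<close> is the conical colimit of \<open>F\<close> restricted to the category of elements, and
  restriction preserves limits, \<open>\<phi>\<close> is flat (\<open>elements_preserves_imp_preserves\<close>).

  All preservation statements are reduced to one about representatives of elements of colimits:
  \<open>preserves_iff_commutes\<close> expresses preservation as injectivity and surjectivity of the comparison
  map, stated for triples up to zig-zags. This uses that limits of set-valued functors are
  pointwise (\<open>is_lim_fun_cat_iff\<close>). The axioms of a universe provide the objects that the definitions
  speak of: regularity the colimits and the smallness of the category of elements, the strong
  limit property the limits of set-valued functors. The existence of the latter matters, because
  preservation of a limit that does not exist would carry no information.
\<close>


section \<open>Small sets\<close>

lemma small_subset: "small B \<Longrightarrow> A \<subseteq> B \<Longrightarrow> small A"
  unfolding small_def by (meson lesspoll_trans1 subset_imp_lepoll)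

lemma small_image:
  fixes A B :: "'u set"
  shows "small A \<Longrightarrow> small (f ` A :: 'u set)"
  unfolding small_def by (meson image_lepoll lesspoll_trans1)

lemma small_singleton: "small {x :: 'u::universe}"
  unfolding small_def by (simp add: finite_lesspoll_infinite infinite_universe)

lemma ex_pair_code: "\<exists>f :: 'u::universe \<times> 'u \<Rightarrow> 'u. inj f"
proof -
  obtain f :: "'u \<times> 'u \<Rightarrow> 'u" where "bij_betw f (UNIV \<times> UNIV) UNIV"
    using card_of_Times_same_infinite[OF infinite_universe] card_of_ordIso by blast
  then show ?thesis by (auto simp: bij_betw_def)
qed

text \<open>
  The objects of a small category are elements of the universe type, so the pairs that make up a
  category of elements have to be coded as such.
\<close>

definition pair_code :: "'u::universe \<Rightarrow> 'u \<Rightarrow> 'u" where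
  "pair_code = curry (SOME f. inj f)"

definition fst_code :: "'u::universe \<Rightarrow> 'u" where
  "fst_code u = (THE x. \<exists>y. u = pair_code x y)"

definition snd_code :: "'u::universe \<Rightarrow> 'u" where
  "snd_code u = (THE y. \<exists>x. u = pair_code x y)"

lemma pair_code_eq [simp]: "pair_code x y = pair_code x' y' \<longleftrightarrow> x = x' \<and> y = y'"
  using someI_ex[OF ex_pair_code] by (auto simp: pair_code_def dest: injD)

lemma fst_pair_code [simp]: "fst_code (pair_code x y) = x"
  by (simp add: fst_code_def)

lemma snd_pair_code [simp]: "snd_code (pair_code x y) = y"
  by (simp add: snd_code_def)

text \<open>
  The strong limit property enters here: a function is determined by its graph, so a product of
  small sets has at most as many elements as the powerset of a small set.
\<close>

lemma PiE_small_code: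
  fixes A :: "'u::universe \<Rightarrow> 'u set"
  assumes I: "small I" and A: "\<And>i. i \<in> I \<Longrightarrow> small (A i)"
  shows "\<exists>enc :: ('u \<Rightarrow> 'u) \<Rightarrow> 'u. inj_on enc (Pi\<^sub>E I A) \<and> small (enc ` Pi\<^sub>E I A)"
proof -
  define U where "U = (\<Union>i\<in>I. pair_code i ` A i)"
  have U: "small U"
    unfolding U_def using I A by (intro regular small_image) auto
  define graph where "graph g = (\<lambda>i. pair_code i (g i)) ` I" for g :: "'u \<Rightarrow> 'u"
  have "inj_on graph (Pi\<^sub>E I A)"
  proof (rule inj_onI)
    fix g h assume gh: "g \<in> Pi\<^sub>E I A" "h \<in> Pi\<^sub>E I A" and eq: "graph g = graph h"
    show "g = h"
    proof (rule PiE_ext[OF gh])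
      fix i assume "i \<in> I"
      then have "pair_code i (g i) \<in> graph h" using eq by (auto simp: graph_def)
      then show "g i = h i" by (auto simp: graph_def)
    qed
  qed
  moreover have "graph ` Pi\<^sub>E I A \<subseteq> Pow U"
    by (auto simp: graph_def U_def)
  ultimately have "Pi\<^sub>E I A \<lesssim> Pow U" unfolding lepoll_def by blast
  then have less: "Pi\<^sub>E I A \<prec> (UNIV :: 'u set)"
    using strong_limit[OF U] lesspoll_trans1 by blast
  then obtain enc :: "('u \<Rightarrow> 'u) \<Rightarrow> 'u" where "inj_on enc (Pi\<^sub>E I A)"
    unfolding lesspoll_def lepoll_def by blast
  moreover have "small (enc ` Pi\<^sub>E I A)"
    unfolding small_def using less by (meson image_lepoll lesspoll_trans1)
  ultimately show ?thesis by blast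
qed


section \<open>Categories and set-valued functors, elementwise\<close>

lemma op_cat_simps [simp]:
  "Obj (op_cat C) = Obj C" "Hom (op_cat C) x y = Hom C y x" "Ident (op_cat C) = Ident C"
  "Comp (op_cat C) x y z g f = Comp C z y x f g"
  by (simp_all add: op_cat_def)

lemma SET_simps [simp]:
  "Obj SET = {A. small A}" "Hom SET A B = A \<rightarrow>\<^sub>E B" "Ident SET A = (\<lambda>x\<in>A. x)"
  "Comp SET A B C g f = compose A g f"
  by (simp_all add: SET_def)

lemma const1_simps [simp]:
  "omap const1 e = {undefined}" "amap const1 x y f = (\<lambda>u\<in>{undefined}. u)"
  by (simp_all add: const1_def)

lemma comp_fctr_simps [simp]:
  "omap (comp_fctr G F) x = omap G (omap F x)"
  "amap (comp_fctr G F) x y f = amap G (omap F x) (omap F y) (amap F x y f)"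
  by (simp_all add: comp_fctr_def)

lemma op_fctr_simps [simp]: "omap (op_fctr F) = omap F" "amap (op_fctr F) x y = amap F y x"
  by (simp_all add: op_fctr_def)

lemma yoneda_simps [simp]:
  "omap (omap (yoneda E) e) x = Hom E e x"
  "amap (omap (yoneda E) e) x y f = (\<lambda>h\<in>Hom E e x. Comp E e x y f h)"
  "amap (yoneda E) e e' k = (\<lambda>x\<in>Obj E. \<lambda>h\<in>Hom E e x. Comp E e' e x h k)"
  by (simp_all add: yoneda_def)

lemma fun_cat_simps [simp]:
  "Obj (fun_cat C K) = {F. is_functor C K F}"
  "Ident (fun_cat C K) F = (\<lambda>x\<in>Obj C. Ident K (omap F x))"
  "Comp (fun_cat C K) F G H t s =
    (\<lambda>x\<in>Obj C. Comp K (omap F x) (omap G x) (omap H x) (t x) (s x))"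
  by (simp_all add: fun_cat_def)

lemma hom_from_simps [simp]:
  "omap (hom_from K X S) c = Hom K X (omap S c)"
  "amap (hom_from K X S) c d f =
    (\<lambda>h\<in>Hom K X (omap S c). Comp K X (omap S c) (omap S d) (amap S c d f) h)"
  by (simp_all add: hom_from_def)

lemma hom_to_simps [simp]:
  "omap (hom_to K S X) c = Hom K (omap S c) X"
  "amap (hom_to K S X) c d f =
    (\<lambda>h\<in>Hom K (omap S c) X. Comp K (omap S d) (omap S c) X h (amap S d c f))"
  by (simp_all add: hom_to_def)

lemma
  assumes "is_category C"
  shows Ident_in_Hom: "x \<in> Obj C \<Longrightarrow> Ident C x \<in> Hom C x x"
    and Comp_in_Hom: "\<lbrakk>x \<in> Obj C; y \<in> Obj C; z \<in> Obj C; f \<in> Hom C x y; g \<in> Hom C y z\<rbrakk>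
      \<Longrightarrow> Comp C x y z g f \<in> Hom C x z"
    and Comp_Ident_right: "\<lbrakk>x \<in> Obj C; y \<in> Obj C; f \<in> Hom C x y\<rbrakk> \<Longrightarrow> Comp C x x y f (Ident C x) = f"
    and Comp_Ident_left: "\<lbrakk>x \<in> Obj C; y \<in> Obj C; f \<in> Hom C x y\<rbrakk> \<Longrightarrow> Comp C x y y (Ident C y) f = f"
    and Comp_assoc: "\<lbrakk>w \<in> Obj C; x \<in> Obj C; y \<in> Obj C; z \<in> Obj C;
        f \<in> Hom C w x; g \<in> Hom C x y; h \<in> Hom C y z\<rbrakk>
      \<Longrightarrow> Comp C w y z h (Comp C w x y g f) = Comp C w x z (Comp C x y z h g) f"
  using assms unfolding is_category_def by blast+

lemma is_category_op: "is_category C \<Longrightarrow> is_category (op_cat C)"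
  unfolding is_category_def by simp

lemma small_category_op: "small_category (op_cat C) \<longleftrightarrow> small_category C"
  using is_category_op[of C] is_category_op[of "op_cat C"] by (auto simp: small_category_def)

text \<open>
  The arrows of \<open>SET\<close> are extensional functions; the criteria below replace equations between them
  by equations between their values.
\<close>

lemma set_functor_iff:
  assumes C: "is_category C"
  shows "is_functor C SET F \<longleftrightarrow>
    (\<forall>x\<in>Obj C. small (omap F x)) \<and>
    (\<forall>x\<in>Obj C. \<forall>y\<in>Obj C. \<forall>f\<in>Hom C x y. amap F x y f \<in> omap F x \<rightarrow>\<^sub>E omap F y) \<and>
    (\<forall>x\<in>Obj C. \<forall>a\<in>omap F x. amap F x x (Ident C x) a = a) \<and>
    (\<forall>x\<in>Obj C. \<forall>y\<in>Obj C. \<forall>z\<in>Obj C. \<forall>f\<in>Hom C x y. \<forall>g\<in>Hom C y z. \<forall>a\<in>omap F x.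
       amap F x z (Comp C x y z g f) a = amap F y z g (amap F x y f a))" (is "?l \<longleftrightarrow> ?r")
proof
  assume ?l
  then show ?r unfolding is_functor_def by (auto simp: compose_def)
next
  assume r: ?r
  have "amap F x x (Ident C x) = (\<lambda>a\<in>omap F x. a)" if "x \<in> Obj C" for x
  proof (rule extensionalityI[where A = "omap F x"])
    show "amap F x x (Ident C x) \<in> extensional (omap F x)"
      using r that Ident_in_Hom[OF C that] by (auto simp: PiE_iff)
  qed (use r that in auto)
  moreover have "amap F x z (Comp C x y z g f) = compose (omap F x) (amap F y z g) (amap F x y f)"
    if o: "x \<in> Obj C" "y \<in> Obj C" "z \<in> Obj C" and h: "f \<in> Hom C x y" "g \<in> Hom C y z" for x y z f g
  proof (rule extensionalityI[where A = "omap F x"])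
    show "amap F x z (Comp C x y z g f) \<in> extensional (omap F x)"
      using r o Comp_in_Hom[OF C o h] by (auto simp: PiE_iff)
  qed (use r o h in \<open>auto simp: compose_def\<close>)
  ultimately show ?l unfolding is_functor_def using r by simp
qed

lemma
  assumes "is_category C" "is_functor C SET F"
  shows set_functor_small: "x \<in> Obj C \<Longrightarrow> small (omap F x)"
    and set_functor_arr: "\<lbrakk>x \<in> Obj C; y \<in> Obj C; f \<in> Hom C x y\<rbrakk> \<Longrightarrow> amap F x y f \<in> omap F x \<rightarrow>\<^sub>E omap F y"
    and set_functor_Ident: "\<lbrakk>x \<in> Obj C; a \<in> omap F x\<rbrakk> \<Longrightarrow> amap F x x (Ident C x) a = a"
    and set_functor_Comp: "\<lbrakk>x \<in> Obj C; y \<in> Obj C; z \<in> Obj C; f \<in> Hom C x y; g \<in> Hom C y z;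
      a \<in> omap F x\<rbrakk> \<Longrightarrow> amap F x z (Comp C x y z g f) a = amap F y z g (amap F x y f a)"
  using assms(2)[unfolded set_functor_iff[OF assms(1)]] by blast+

lemma set_functor_app:
  assumes "is_category C" "is_functor C SET F"
  shows "\<lbrakk>x \<in> Obj C; y \<in> Obj C; f \<in> Hom C x y; a \<in> omap F x\<rbrakk> \<Longrightarrow> amap F x y f a \<in> omap F y"
  using set_functor_arr[OF assms, of x y f] by (simp add: PiE_iff)

lemma presheaf_app:
  assumes "is_category E" "is_functor (op_cat E) SET P"
  shows "\<lbrakk>x \<in> Obj E; y \<in> Obj E; f \<in> Hom E x y; p \<in> omap P y\<rbrakk> \<Longrightarrow> amap P y x f p \<in> omap P x"
  using set_functor_app[OF is_category_op[OF assms(1)] assms(2), of y x f p] by simp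

lemma presheaf_Ident:
  assumes "is_category E" "is_functor (op_cat E) SET P"
  shows "\<lbrakk>x \<in> Obj E; p \<in> omap P x\<rbrakk> \<Longrightarrow> amap P x x (Ident E x) p = p"
  using set_functor_Ident[OF is_category_op[OF assms(1)] assms(2), of x p] by simp

lemma presheaf_Comp:
  assumes "is_category E" "is_functor (op_cat E) SET P"
  shows "\<lbrakk>x \<in> Obj E; y \<in> Obj E; z \<in> Obj E; f \<in> Hom E x y; g \<in> Hom E y z; p \<in> omap P z\<rbrakk>
    \<Longrightarrow> amap P z x (Comp E x y z g f) p = amap P y x f (amap P z y g p)"
  using set_functor_Comp[OF is_category_op[OF assms(1)] assms(2), of z y x g f p] by simp

lemma Hom_fun_cat_SET:
  assumes "is_category C" "is_functor C SET F" "is_functor C SET G"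
  shows "Hom (fun_cat C SET) F G = set_nat C F G"
proof -
  have eq: "compose (omap F x) (t y) (amap F x y f) = compose (omap F x) (amap G x y f) (t x) \<longleftrightarrow>
      (\<forall>a\<in>omap F x. t y (amap F x y f a) = amap G x y f (t x a))" for t x y f
    by (auto simp: compose_def fun_eq_iff restrict_def)
  show ?thesis by (simp add: fun_cat_def set_nat_def eq)
qed

lemma set_natI:
  assumes "\<And>x. x \<in> Obj C \<Longrightarrow> t x \<in> omap F x \<rightarrow>\<^sub>E omap G x" "t \<in> extensional (Obj C)"
    "\<And>x y f a. \<lbrakk>x \<in> Obj C; y \<in> Obj C; f \<in> Hom C x y; a \<in> omap F x\<rbrakk>
      \<Longrightarrow> t y (amap F x y f a) = amap G x y f (t x a)"
  shows "t \<in> set_nat C F G"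
  using assms by (auto simp: set_nat_def PiE_iff)

lemma
  assumes "t \<in> set_nat C F G"
  shows set_nat_arr: "x \<in> Obj C \<Longrightarrow> t x \<in> omap F x \<rightarrow>\<^sub>E omap G x"
    and set_nat_ext: "t \<in> extensional (Obj C)"
    and set_nat_natural: "\<lbrakk>x \<in> Obj C; y \<in> Obj C; f \<in> Hom C x y; a \<in> omap F x\<rbrakk>
      \<Longrightarrow> t y (amap F x y f a) = amap G x y f (t x a)"
    and set_nat_app: "\<lbrakk>x \<in> Obj C; a \<in> omap F x\<rbrakk> \<Longrightarrow> t x a \<in> omap G x"
  using assms by (auto simp: set_nat_def PiE_iff)

lemma set_nat_eqI:
  assumes "s \<in> set_nat C F G" "t \<in> set_nat C F G"
    "\<And>x a. \<lbrakk>x \<in> Obj C; a \<in> omap F x\<rbrakk> \<Longrightarrow> s x a = t x a"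
  shows "s = t"
proof (rule extensionalityI[OF set_nat_ext[OF assms(1)] set_nat_ext[OF assms(2)]])
  fix x assume x: "x \<in> Obj C"
  show "s x = t x"
    using set_nat_arr[OF assms(1) x] set_nat_arr[OF assms(2) x] assms(3)[OF x] by (rule PiE_ext)
qed

lemma set_nat_comp:
  assumes "s \<in> set_nat C F G" "t \<in> set_nat C G H"
    "\<And>x y f. \<lbrakk>x \<in> Obj C; y \<in> Obj C; f \<in> Hom C x y\<rbrakk> \<Longrightarrow> amap F x y f \<in> omap F x \<rightarrow>\<^sub>E omap F y"
  shows "(\<lambda>x\<in>Obj C. compose (omap F x) (t x) (s x)) \<in> set_nat C F H"
proof (rule set_natI, goal_cases)
  case (1 x)
  then show ?case
    using set_nat_app[OF assms(1)] set_nat_app[OF assms(2)] by (auto simp: compose_def)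
next
  case (3 x y f a)
  then have "amap F x y f a \<in> omap F y" using assms(3)[of x y f] by auto
  then show ?case
    using 3 set_nat_app[OF assms(1)] set_nat_natural[OF assms(1), of x y f a]
      set_nat_natural[OF assms(2), of x y f "s x a"] by (simp add: compose_def)
qed auto

lemma fun_cat_functor_iff:
  assumes C: "is_category C" and E: "is_category E"
  shows "is_functor C (fun_cat E SET) S \<longleftrightarrow>
    (\<forall>c\<in>Obj C. is_functor E SET (omap S c)) \<and>
    (\<forall>c\<in>Obj C. \<forall>c'\<in>Obj C. \<forall>f\<in>Hom C c c'. amap S c c' f \<in> set_nat E (omap S c) (omap S c')) \<and>
    (\<forall>c\<in>Obj C. \<forall>e\<in>Obj E. \<forall>a\<in>omap (omap S c) e. amap S c c (Ident C c) e a = a) \<and>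
    (\<forall>x\<in>Obj C. \<forall>y\<in>Obj C. \<forall>z\<in>Obj C. \<forall>f\<in>Hom C x y. \<forall>g\<in>Hom C y z.
       \<forall>e\<in>Obj E. \<forall>a\<in>omap (omap S x) e.
       amap S x z (Comp C x y z g f) e a = amap S y z g e (amap S x y f e a))" (is "?l \<longleftrightarrow> ?r")
proof
  assume l: ?l
  then have F: "\<forall>c\<in>Obj C. is_functor E SET (omap S c)" by (simp add: is_functor_def[of C])
  show ?r using l F unfolding is_functor_def[of C "fun_cat E SET"]
    by (auto simp: Hom_fun_cat_SET[OF E] compose_def)
next
  assume r: ?r
  have "amap S x x (Ident C x) = (\<lambda>e\<in>Obj E. \<lambda>a\<in>omap (omap S x) e. a)" if "x \<in> Obj C" for x
  proof (rule set_nat_eqI)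
    show "amap S x x (Ident C x) \<in> set_nat E (omap S x) (omap S x)"
      using r that Ident_in_Hom[OF C that] by blast
    show "(\<lambda>e\<in>Obj E. \<lambda>a\<in>omap (omap S x) e. a) \<in> set_nat E (omap S x) (omap S x)"
      using r that set_functor_app[OF E, of "omap S x"] by (auto intro!: set_natI)
  qed (use r that in auto)
  moreover have "amap S x z (Comp C x y z g f) =
      (\<lambda>e\<in>Obj E. compose (omap (omap S x) e) (amap S y z g e) (amap S x y f e))"
    if o: "x \<in> Obj C" "y \<in> Obj C" "z \<in> Obj C" and h: "f \<in> Hom C x y" "g \<in> Hom C y z" for x y z f g
  proof (rule set_nat_eqI)
    show "amap S x z (Comp C x y z g f) \<in> set_nat E (omap S x) (omap S z)"
      using r o Comp_in_Hom[OF C o h] by blast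
    show "(\<lambda>e\<in>Obj E. compose (omap (omap S x) e) (amap S y z g e) (amap S x y f e))
        \<in> set_nat E (omap S x) (omap S z)"
      using r o h set_functor_arr[OF E, of "omap S x"] by (intro set_nat_comp[where G = "omap S y"]) auto
  qed (use r o h in \<open>auto simp: compose_def\<close>)
  ultimately show ?l
    unfolding is_functor_def[of C "fun_cat E SET"] using r by (simp add: Hom_fun_cat_SET[OF E])
qed

lemma functor_yoneda:
  assumes "small_category E" "x \<in> Obj E"
  shows "is_functor E SET (omap (yoneda E) x)"
proof -
  have E: "is_category E" using assms by (simp add: small_category_def)
  show ?thesis
    unfolding set_functor_iff[OF E]
    using assms Comp_in_Hom[OF E assms(2)] Comp_Ident_left[OF E assms(2)] Comp_assoc[OF E assms(2)]
    by (auto simp: small_category_def)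
qed


section \<open>Limits weighted by the conical weight\<close>

definition cones :: "('p, 'b) cat \<Rightarrow> ('o, 'a) cat \<Rightarrow> ('o, 'p, 'a, 'b) fctr \<Rightarrow> 'p \<Rightarrow> ('o \<Rightarrow> 'b) set" where
  "cones K D S X = {k \<in> (\<Pi>\<^sub>E d\<in>Obj D. Hom K X (omap S d)).
    \<forall>d\<in>Obj D. \<forall>d'\<in>Obj D. \<forall>f\<in>Hom D d d'.
      Comp K X (omap S d') (omap S d) (amap S d' d f) (k d') = k d}"

definition is_lim :: "('p, 'b) cat \<Rightarrow> ('o, 'a) cat \<Rightarrow> ('o, 'p, 'a, 'b) fctr \<Rightarrow> 'p \<Rightarrow> ('o \<Rightarrow> 'b) \<Rightarrow> bool" where
  "is_lim K D S L m \<longleftrightarrow> L \<in> Obj K \<and> m \<in> cones K D S L \<and>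
    (\<forall>X\<in>Obj K. bij_betw (\<lambda>h. \<lambda>d\<in>Obj D. Comp K X L (omap S d) (m d) h) (Hom K X L) (cones K D S X))"

text \<open>
  The only element of the value of \<open>const1\<close> is \<open>undefined\<close>, so a transformation from \<open>const1\<close> to
  \<open>K(X, S-)\<close> is a cone with vertex \<open>X\<close>.
\<close>

definition conical_unit :: "('u, 'u) cat \<Rightarrow> ('u \<Rightarrow> 'b) \<Rightarrow> 'u \<Rightarrow> 'u \<Rightarrow> 'b" where
  "conical_unit D k = (\<lambda>d\<in>Obj D. \<lambda>p\<in>{undefined}. k d)"

lemma is_lim_bij:
  "is_lim K D S L m \<Longrightarrow> X \<in> Obj K \<Longrightarrow>
    bij_betw (\<lambda>h. \<lambda>d\<in>Obj D. Comp K X L (omap S d) (m d) h) (Hom K X L) (cones K D S X)"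
  by (simp add: is_lim_def)

lemma is_lim_cone: "is_lim K D S L m \<Longrightarrow> m \<in> cones K D S L"
  by (simp add: is_lim_def)

lemma cones_ext: "k \<in> cones K D S X \<Longrightarrow> k \<in> extensional (Obj D)"
  by (simp add: cones_def PiE_iff)

lemma bij_conical_unit:
  "bij_betw (conical_unit D) (cones K D S X) (set_nat (op_cat D) const1 (hom_from K X S))"
proof (rule bij_betw_byWitness[where f' = "\<lambda>\<alpha>. \<lambda>d\<in>Obj D. \<alpha> d undefined"])
  show "\<forall>k\<in>cones K D S X. (\<lambda>d\<in>Obj D. conical_unit D k d undefined) = k"
    by (auto simp: cones_def conical_unit_def PiE_iff extensional_restrict cong: restrict_cong)
  show "\<forall>\<alpha>\<in>set_nat (op_cat D) const1 (hom_from K X S).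
      conical_unit D (\<lambda>d\<in>Obj D. \<alpha> d undefined) = \<alpha>"
    by (auto simp: set_nat_def conical_unit_def PiE_iff extensional_def fun_eq_iff restrict_def)
  show "conical_unit D ` cones K D S X \<subseteq> set_nat (op_cat D) const1 (hom_from K X S)"
    by (auto simp: set_nat_def cones_def conical_unit_def PiE_iff)
  show "(\<lambda>\<alpha>. \<lambda>d\<in>Obj D. \<alpha> d undefined) ` set_nat (op_cat D) const1 (hom_from K X S) \<subseteq> cones K D S X"
    by (auto simp: set_nat_def cones_def PiE_iff)
qed

lemma is_wlim_conical_unit:
  fixes D :: "('u, 'u) cat" and m :: "'u \<Rightarrow> 'b"
  assumes m: "m \<in> extensional (Obj D)"
  shows "is_wlim K D const1 S L (conical_unit D m) \<longleftrightarrow> is_lim K D S L m"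
proof -
  have inj: "conical_unit D k = conical_unit D k' \<longleftrightarrow> k = k'"
    if k: "k \<in> extensional (Obj D)" "k' \<in> extensional (Obj D)" for k k' :: "'u \<Rightarrow> 'b"
  proof
    assume eq: "conical_unit D k = conical_unit D k'"
    have "k d = k' d" if "d \<in> Obj D" for d
      using fun_cong[OF fun_cong[OF eq, of d], of undefined] that by (simp add: conical_unit_def)
    then show "k = k'" using k by (auto intro: extensionalityI)
  qed simp
  have mem: "conical_unit D k \<in> set_nat (op_cat D) const1 (hom_from K X S)
      \<longleftrightarrow> k \<in> cones K D S X"
    if k: "k \<in> extensional (Obj D)" for k X
  proof
    assume "conical_unit D k \<in> set_nat (op_cat D) const1 (hom_from K X S)"
    then obtain k' where k': "k' \<in> cones K D S X" "conical_unit D k = conical_unit D k'"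
      using bij_conical_unit[of D K S X] unfolding bij_betw_def by blast
    then show "k \<in> cones K D S X" using inj[OF k cones_ext[OF k'(1)]] by simp
  next
    assume "k \<in> cones K D S X"
    then show "conical_unit D k \<in> set_nat (op_cat D) const1 (hom_from K X S)"
      using bij_betwE[OF bij_conical_unit[of D K S X]] by blast
  qed
  let ?f = "\<lambda>X h. \<lambda>d\<in>Obj D. Comp K X L (omap S d) (m d) h"
  have "bij_betw (\<lambda>h. \<lambda>d\<in>Obj D. \<lambda>p\<in>omap const1 d. Comp K X L (omap S d) (conical_unit D m d p) h)
      (Hom K X L) (set_nat (op_cat D) const1 (hom_from K X S)) \<longleftrightarrow>
    bij_betw (?f X) (Hom K X L) (cones K D S X)" for X
  proof -
    have *: "(\<lambda>d\<in>Obj D. \<lambda>p\<in>omap const1 d. Comp K X L (omap S d) (conical_unit D m d p) h)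
        = conical_unit D (?f X h)" for h
      by (auto simp: conical_unit_def fun_eq_iff)
    have "bij_betw (conical_unit D \<circ> ?f X) (Hom K X L) (set_nat (op_cat D) const1 (hom_from K X S))
        \<longleftrightarrow> bij_betw (?f X) (Hom K X L) (cones K D S X)" (is "?a \<longleftrightarrow> ?b")
    proof
      assume ?b then show ?a using bij_conical_unit by (rule bij_betw_trans)
    next
      assume a: ?a
      have "?f X ` Hom K X L \<subseteq> cones K D S X"
      proof
        fix k assume "k \<in> ?f X ` Hom K X L"
        then obtain h where h: "h \<in> Hom K X L" "k = ?f X h" by blast
        have "conical_unit D k \<in> set_nat (op_cat D) const1 (hom_from K X S)"
          using bij_betw_apply[OF a h(1)] h(2) by simp
        then show "k \<in> cones K D S X" using mem[of k X] h(2) by simp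
      qed
      then show ?b using a by (rule bij_betw_comp_iff2[OF bij_conical_unit, THEN iffD2])
    qed
    then show ?thesis unfolding * comp_def .
  qed
  then show ?thesis unfolding is_wlim_def is_lim_def using mem[OF m, of L] by simp
qed

text \<open>
  Every unit of a limit weighted by \<open>const1\<close> comes from a unique cone, so a quantifier over units can
  be replaced by one over cones.
\<close>

lemma preserves_wlim_const1_iff:
  "preserves_wlim K K' G D const1 S \<longleftrightarrow>
    (\<forall>L m. is_lim K D S L m \<longrightarrow>
      is_lim K' D (comp_fctr G S) (omap G L) (\<lambda>d\<in>Obj D. amap G L (omap S d) (m d)))"
proof -
  have unit: "(\<lambda>d\<in>Obj D. \<lambda>p\<in>omap const1 d. amap G L (omap S d) (conical_unit D m d p)) =
      conical_unit D (\<lambda>d\<in>Obj D. amap G L (omap S d) (m d))" for L m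
    by (auto simp: conical_unit_def fun_eq_iff)
  have "(\<forall>l. is_wlim K D const1 S L l \<longrightarrow> P l) \<longleftrightarrow> (\<forall>m. is_lim K D S L m \<longrightarrow> P (conical_unit D m))" for P L
  proof (intro iffI allI impI)
    fix m assume *: "\<forall>l. is_wlim K D const1 S L l \<longrightarrow> P l" and m: "is_lim K D S L m"
    have "m \<in> extensional (Obj D)" using cones_ext[OF is_lim_cone[OF m]] .
    then have "is_wlim K D const1 S L (conical_unit D m)" using m by (simp add: is_wlim_conical_unit)
    then show "P (conical_unit D m)" using *[rule_format] by blast
  next
    fix l assume *: "\<forall>m. is_lim K D S L m \<longrightarrow> P (conical_unit D m)" and l: "is_wlim K D const1 S L l"
    have "l \<in> set_nat (op_cat D) const1 (hom_from K L S)" using l by (simp add: is_wlim_def)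
    then obtain m where m: "m \<in> cones K D S L" "l = conical_unit D m"
      using bij_conical_unit[of D K S L] unfolding bij_betw_def by blast
    have "m \<in> extensional (Obj D)" using cones_ext[OF m(1)] .
    then have "is_lim K D S L m" using l unfolding m(2) by (simp only: is_wlim_conical_unit)
    then show "P l" using *[rule_format] m(2) by blast
  qed
  then show ?thesis unfolding preserves_wlim_def
    by (simp add: unit is_wlim_conical_unit del: const1_simps)
qed


section \<open>Limits of sets and of set-valued functors\<close>

definition matching :: "('o, 'a) cat \<Rightarrow> ('o, 'v set, 'a, 'v \<Rightarrow> 'v) fctr \<Rightarrow> ('o \<Rightarrow> 'v) set" where
  "matching D G = {y \<in> (\<Pi>\<^sub>E d\<in>Obj D. omap G d).
    \<forall>d\<in>Obj D. \<forall>d'\<in>Obj D. \<forall>f\<in>Hom D d d'. amap G d' d f (y d') = y d}"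

lemma cones_SET:
  assumes "\<And>d d' f. \<lbrakk>d \<in> Obj D; d' \<in> Obj D; f \<in> Hom D d d'\<rbrakk> \<Longrightarrow> amap G d' d f \<in> omap G d' \<rightarrow> omap G d"
  shows "k \<in> cones SET D G X \<longleftrightarrow> k \<in> (\<Pi>\<^sub>E d\<in>Obj D. X \<rightarrow>\<^sub>E omap G d) \<and>
    (\<forall>x\<in>X. (\<lambda>d\<in>Obj D. k d x) \<in> matching D G)"
proof -
  have comp: "compose X g k' = k'' \<longleftrightarrow> (\<forall>x\<in>X. g (k' x) = k'' x)" if "k'' \<in> extensional X" for g k' k''
    using that by (auto simp: fun_eq_iff compose_def restrict_def extensional_def)
  have "k \<in> cones SET D G X \<longleftrightarrow> k \<in> (\<Pi>\<^sub>E d\<in>Obj D. X \<rightarrow>\<^sub>E omap G d) \<and>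
    (\<forall>d\<in>Obj D. \<forall>d'\<in>Obj D. \<forall>f\<in>Hom D d d'. \<forall>x\<in>X. amap G d' d f (k d' x) = k d x)"
    by (auto simp: cones_def PiE_iff comp)
  then show ?thesis by (auto simp: matching_def PiE_iff)
qed

text \<open>
  A cone with vertex \<open>X\<close> is an \<open>X\<close>-indexed family of matching families. The universal property for
  one-point \<open>X\<close> therefore says that \<open>L\<close> is in bijection with the matching families, and this implies it
  for all \<open>X\<close>.
\<close>

lemma is_lim_SET_iff:
  assumes G: "\<And>d d' f. \<lbrakk>d \<in> Obj D; d' \<in> Obj D; f \<in> Hom D d d'\<rbrakk> \<Longrightarrow> amap G d' d f \<in> omap G d' \<rightarrow> omap G d"
    and L: "small (L :: 'u::universe set)" and m: "m \<in> cones SET D G L"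
  shows "is_lim SET D G L m \<longleftrightarrow> bij_betw (\<lambda>z. \<lambda>d\<in>Obj D. m d z) L (matching D G)" (is "?l \<longleftrightarrow> ?r")
proof -
  have C: "k \<in> cones SET D G X \<longleftrightarrow> k \<in> (\<Pi>\<^sub>E d\<in>Obj D. X \<rightarrow>\<^sub>E omap G d) \<and>
    (\<forall>x\<in>X. (\<lambda>d\<in>Obj D. k d x) \<in> matching D G)" for k X
    by (rule cones_SET) (rule G)
  have mm: "m \<in> (\<Pi>\<^sub>E d\<in>Obj D. L \<rightarrow>\<^sub>E omap G d)" "\<forall>z\<in>L. (\<lambda>d\<in>Obj D. m d z) \<in> matching D G"
    using m unfolding C by auto
  show ?thesis
  proof
    assume ?l
    let ?X = "{undefined :: 'u}"
    have bij: "bij_betw (\<lambda>h. \<lambda>d\<in>Obj D. compose ?X (m d) h) (?X \<rightarrow>\<^sub>E L) (cones SET D G ?X)"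
      using is_lim_bij[OF \<open>?l\<close>, of ?X] by (simp add: small_singleton)
    show ?r unfolding bij_betw_def
    proof (intro conjI inj_onI equalityI subsetI)
      fix z z' assume z: "z \<in> L" "z' \<in> L" and eq: "(\<lambda>d\<in>Obj D. m d z) = (\<lambda>d\<in>Obj D. m d z')"
      have "m d z = m d z'" if "d \<in> Obj D" for d using fun_cong[OF eq, of d] that by simp
      then have "(\<lambda>d\<in>Obj D. compose ?X (m d) (\<lambda>x\<in>?X. z)) = (\<lambda>d\<in>Obj D. compose ?X (m d) (\<lambda>x\<in>?X. z'))"
        by (auto simp: compose_def fun_eq_iff)
      then have "(\<lambda>x\<in>?X. z) = (\<lambda>x\<in>?X. z')"
        using z by (intro inj_onD[OF bij_betw_imp_inj_on[OF bij]]) auto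
      then show "z = z'" by (metis restrict_apply' singletonI)
    next
      fix y assume "y \<in> (\<lambda>z. \<lambda>d\<in>Obj D. m d z) ` L"
      then show "y \<in> matching D G" using mm(2) by auto
    next
      fix y assume y: "y \<in> matching D G"
      then have "(\<lambda>d\<in>Obj D. y d) = y" by (auto simp: matching_def PiE_iff extensional_restrict)
      then have "(\<lambda>d\<in>Obj D. \<lambda>x\<in>?X. y d) \<in> cones SET D G ?X"
        using y by (auto simp: C matching_def PiE_iff cong: restrict_cong)
      then obtain h where h: "h \<in> ?X \<rightarrow>\<^sub>E L"
          "(\<lambda>d\<in>Obj D. \<lambda>x\<in>?X. y d) = (\<lambda>d\<in>Obj D. compose ?X (m d) h)"
        using bij unfolding bij_betw_def by blast
      have "y d = m d (h undefined)" if "d \<in> Obj D" for d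
        using fun_cong[OF fun_cong[OF h(2), of d], of undefined] that by (simp add: compose_def)
      then have "y = (\<lambda>d\<in>Obj D. m d (h undefined))"
        using y by (auto simp: matching_def PiE_iff intro!: extensionalityI[of y "Obj D"])
      then show "y \<in> (\<lambda>z. \<lambda>d\<in>Obj D. m d z) ` L" using h(1) by auto
    qed
  next
    assume r: ?r
    have "bij_betw (\<lambda>h. \<lambda>d\<in>Obj D. compose X (m d) h) (X \<rightarrow>\<^sub>E L) (cones SET D G X)" for X :: "'u set"
      unfolding bij_betw_def
    proof (intro conjI inj_onI equalityI subsetI)
      fix h h' assume h: "h \<in> X \<rightarrow>\<^sub>E L" "h' \<in> X \<rightarrow>\<^sub>E L"
        and eq: "(\<lambda>d\<in>Obj D. compose X (m d) h) = (\<lambda>d\<in>Obj D. compose X (m d) h')"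
      show "h = h'"
      proof (rule PiE_ext[OF h])
        fix x assume x: "x \<in> X"
        have "m d (h x) = m d (h' x)" if "d \<in> Obj D" for d
          using fun_cong[OF fun_cong[OF eq, of d], of x] that x by (simp add: compose_def)
        then have "(\<lambda>d\<in>Obj D. m d (h x)) = (\<lambda>d\<in>Obj D. m d (h' x))" by auto
        then show "h x = h' x" using h x r by (auto simp: bij_betw_def inj_on_def)
      qed
    next
      fix k assume "k \<in> (\<lambda>h. \<lambda>d\<in>Obj D. compose X (m d) h) ` (X \<rightarrow>\<^sub>E L)"
      then obtain h where h: "h \<in> X \<rightarrow>\<^sub>E L" and k: "k = (\<lambda>d\<in>Obj D. compose X (m d) h)" by blast
      have "(\<lambda>d\<in>Obj D. k d x) = (\<lambda>d\<in>Obj D. m d (h x))" if "x \<in> X" for x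
        using that by (auto simp: k compose_def)
      moreover have "k \<in> (\<Pi>\<^sub>E d\<in>Obj D. X \<rightarrow>\<^sub>E omap G d)"
        using mm(1) h by (auto simp: k compose_def PiE_iff)
      ultimately show "k \<in> cones SET D G X"
        unfolding C using mm(2) h by auto
    next
      fix k assume k: "k \<in> cones SET D G X"
      have "\<forall>x\<in>X. \<exists>z\<in>L. (\<lambda>d\<in>Obj D. k d x) = (\<lambda>d\<in>Obj D. m d z)"
        using k r unfolding C bij_betw_def by blast
      then obtain h where h: "\<forall>x\<in>X. h x \<in> L \<and> (\<lambda>d\<in>Obj D. k d x) = (\<lambda>d\<in>Obj D. m d (h x))" by metis
      have "k = (\<lambda>d\<in>Obj D. compose X (m d) (restrict h X))"
      proof (rule extensionalityI[of _ "Obj D"])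
        fix d assume d: "d \<in> Obj D"
        have "k d x = m d (h x)" if "x \<in> X" for x
          using h that fun_cong[of "\<lambda>d\<in>Obj D. k d x" _ d] d by fastforce
        then show "k d = (\<lambda>d\<in>Obj D. compose X (m d) (restrict h X)) d"
          using k d by (auto simp: C compose_def PiE_iff intro!: extensionalityI[of "k d" X])
      qed (use k in \<open>auto simp: C PiE_iff\<close>)
      then show "k \<in> (\<lambda>h. \<lambda>d\<in>Obj D. compose X (m d) h) ` (X \<rightarrow>\<^sub>E L)" using h by auto
    qed
    then show ?l using L m unfolding is_lim_def by simp
  qed
qed

definition value_at :: "('o, ('p, 'v set, 'b, 'v \<Rightarrow> 'v) fctr, 'a, 'p \<Rightarrow> 'v \<Rightarrow> 'v) fctr \<Rightarrow> 'p
    \<Rightarrow> ('o, 'v set, 'a, 'v \<Rightarrow> 'v) fctr" where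
  "value_at S e = \<lparr> omap = (\<lambda>d. omap (omap S d) e), amap = (\<lambda>d d' f. amap S d d' f e) \<rparr>"

lemma value_at_simps [simp]:
  "omap (value_at S e) d = omap (omap S d) e" "amap (value_at S e) d d' f = amap S d d' f e"
  by (simp_all add: value_at_def)

text \<open>
  A weight on \<open>D\<close> is a presheaf, so the diagrams of which it weights the limits are contravariant:
  an arrow from \<open>d\<close> to \<open>d'\<close> acts from \<open>S d'\<close> to \<open>S d\<close>.
\<close>

locale diagram =
  fixes D :: "('u::universe, 'u) cat" and E :: "('u, 'u) cat"
    and S :: "('u, ('u, 'u set, 'u, 'u \<Rightarrow> 'u) fctr, 'u, 'u \<Rightarrow> 'u \<Rightarrow> 'u) fctr"
  assumes D: "small_category D" and E: "small_category E"
    and S: "is_functor (op_cat D) (fun_cat E SET) S"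
begin

lemma catD: "is_category D" and catE: "is_category E"
  using D E by (auto simp: small_category_def)

lemma functor_at: "d \<in> Obj D \<Longrightarrow> is_functor E SET (omap S d)"
  using S[unfolded fun_cat_functor_iff[OF is_category_op[OF catD] catE]] by simp

lemma transition: "\<lbrakk>d \<in> Obj D; d' \<in> Obj D; f \<in> Hom D d d'\<rbrakk>
    \<Longrightarrow> amap S d' d f \<in> set_nat E (omap S d') (omap S d)"
  using S[unfolded fun_cat_functor_iff[OF is_category_op[OF catD] catE]] by simp

lemma cones_fun_cat:
  assumes X: "is_functor E SET X"
  shows "k \<in> cones (fun_cat E SET) D S X \<longleftrightarrow> k \<in> (\<Pi>\<^sub>E d\<in>Obj D. set_nat E X (omap S d)) \<and>
    (\<forall>e\<in>Obj E. \<forall>x\<in>omap X e. (\<lambda>d\<in>Obj D. k d e x) \<in> matching D (value_at S e))" (is "?l \<longleftrightarrow> ?r")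
proof -
  have comp: "(\<lambda>e\<in>Obj E. compose (omap X e) (amap S d' d f e) (k d' e)) = k d \<longleftrightarrow>
      (\<forall>e\<in>Obj E. \<forall>x\<in>omap X e. amap S d' d f e (k d' e x) = k d e x)"
    if k: "k \<in> (\<Pi>\<^sub>E d\<in>Obj D. set_nat E X (omap S d))" and d: "d \<in> Obj D" "d' \<in> Obj D" "f \<in> Hom D d d'"
    for d d' f
  proof
    assume eq: "(\<lambda>e\<in>Obj E. compose (omap X e) (amap S d' d f e) (k d' e)) = k d"
    show "\<forall>e\<in>Obj E. \<forall>x\<in>omap X e. amap S d' d f e (k d' e x) = k d e x"
      by (auto simp: eq[symmetric] compose_def)
  next
    assume eq: "\<forall>e\<in>Obj E. \<forall>x\<in>omap X e. amap S d' d f e (k d' e x) = k d e x"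
    show "(\<lambda>e\<in>Obj E. compose (omap X e) (amap S d' d f e) (k d' e)) = k d"
    proof (rule set_nat_eqI)
      show "(\<lambda>e\<in>Obj E. compose (omap X e) (amap S d' d f e) (k d' e)) \<in> set_nat E X (omap S d)"
        using k d transition[OF d] by (intro set_nat_comp[where G = "omap S d'"] set_functor_arr[OF catE X]) auto
      show "k d \<in> set_nat E X (omap S d)" using k d by auto
    qed (simp add: eq compose_def)
  qed
  have "k \<in> cones (fun_cat E SET) D S X \<longleftrightarrow> k \<in> (\<Pi>\<^sub>E d\<in>Obj D. set_nat E X (omap S d)) \<and>
    (\<forall>d\<in>Obj D. \<forall>d'\<in>Obj D. \<forall>f\<in>Hom D d d'.
      (\<lambda>e\<in>Obj E. compose (omap X e) (amap S d' d f e) (k d' e)) = k d)"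
    using Hom_fun_cat_SET[OF catE X functor_at] by (auto simp: cones_def PiE_iff)
  also have "\<dots> \<longleftrightarrow> k \<in> (\<Pi>\<^sub>E d\<in>Obj D. set_nat E X (omap S d)) \<and>
    (\<forall>d\<in>Obj D. \<forall>d'\<in>Obj D. \<forall>f\<in>Hom D d d'.
      \<forall>e\<in>Obj E. \<forall>x\<in>omap X e. amap S d' d f e (k d' e x) = k d e x)"
    using comp by blast
  also have "\<dots> \<longleftrightarrow> ?r"
    by (auto simp: matching_def PiE_iff dest: set_nat_app)
  finally show ?thesis .
qed

lemma cone_components:
  assumes "is_functor E SET X" "k \<in> cones (fun_cat E SET) D S X"
  shows "d \<in> Obj D \<Longrightarrow> k d \<in> set_nat E X (omap S d)"
    and "k \<in> extensional (Obj D)"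
    and "\<lbrakk>e \<in> Obj E; x \<in> omap X e\<rbrakk> \<Longrightarrow> (\<lambda>d\<in>Obj D. k d e x) \<in> matching D (value_at S e)"
    and "\<lbrakk>d \<in> Obj D; d' \<in> Obj D; f \<in> Hom D d d'; e \<in> Obj E; x \<in> omap X e\<rbrakk>
      \<Longrightarrow> amap S d' d f e (k d' e x) = k d e x"
proof -
  note k = assms(2)[unfolded cones_fun_cat[OF assms(1)]]
  show "d \<in> Obj D \<Longrightarrow> k d \<in> set_nat E X (omap S d)" and "k \<in> extensional (Obj D)"
    and *: "\<lbrakk>e \<in> Obj E; x \<in> omap X e\<rbrakk> \<Longrightarrow> (\<lambda>d\<in>Obj D. k d e x) \<in> matching D (value_at S e)"
    using k by (auto simp: PiE_iff)
  show "amap S d' d f e (k d' e x) = k d e x"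
    if "d \<in> Obj D" "d' \<in> Obj D" "f \<in> Hom D d d'" "e \<in> Obj E" "x \<in> omap X e"
    using *[OF that(4,5)] that(1-3) by (auto simp: matching_def)
qed

text \<open>
  Limits of set-valued functors are computed pointwise: a cone with vertex representable by \<open>e\<close> is, by
  the Yoneda lemma, a matching family at \<open>e\<close>, so the universal property at representable vertices
  already says that \<open>L\<close> is a pointwise limit.
\<close>

lemma is_lim_fun_cat_iff:
  assumes L: "is_functor E SET L" and m: "m \<in> cones (fun_cat E SET) D S L"
  shows "is_lim (fun_cat E SET) D S L m \<longleftrightarrow>
    (\<forall>e\<in>Obj E. bij_betw (\<lambda>z. \<lambda>d\<in>Obj D. m d e z) (omap L e) (matching D (value_at S e)))"
    (is "?l \<longleftrightarrow> ?r")
proof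
  note nat_m = cone_components[OF L m]
  assume ?l
  show ?r
  proof
    fix e assume e: "e \<in> Obj E"
    let ?Y = "omap (yoneda E) e"
    have Y: "is_functor E SET ?Y" using functor_yoneda[OF E e] .
    have bij: "bij_betw (\<lambda>h. \<lambda>d\<in>Obj D. \<lambda>x\<in>Obj E. compose (Hom E e x) (m d x) (h x))
        (set_nat E ?Y L) (cones (fun_cat E SET) D S ?Y)"
      using is_lim_bij[OF \<open>?l\<close>, of ?Y] Y Hom_fun_cat_SET[OF catE Y L] by simp
    \<comment> \<open>The transformation that corresponds to \<open>z\<close> under the Yoneda lemma.\<close>
    define el where "el z = (\<lambda>x\<in>Obj E. \<lambda>g\<in>Hom E e x. amap L e x g z)" for z
    have el: "el z \<in> set_nat E ?Y L" if "z \<in> omap L e" for z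
      using that e set_functor_app[OF catE L] set_functor_Comp[OF catE L] Comp_in_Hom[OF catE]
      by (auto simp: el_def intro!: set_natI)
    show "bij_betw (\<lambda>z. \<lambda>d\<in>Obj D. m d e z) (omap L e) (matching D (value_at S e))"
      unfolding bij_betw_def
    proof (intro conjI inj_onI equalityI subsetI)
      fix z z' assume z: "z \<in> omap L e" "z' \<in> omap L e"
        and eq: "(\<lambda>d\<in>Obj D. m d e z) = (\<lambda>d\<in>Obj D. m d e z')"
      have eq': "m d e z = m d e z'" if "d \<in> Obj D" for d using fun_cong[OF eq, of d] that by simp
      have "m d x (amap L e x g z) = m d x (amap L e x g z')"
        if "d \<in> Obj D" "x \<in> Obj E" "g \<in> Hom E e x" for d x g
        using set_nat_natural[OF nat_m(1)[OF that(1)] e that(2,3)] z eq'[OF that(1)] by simp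
      then have "(\<lambda>d\<in>Obj D. \<lambda>x\<in>Obj E. compose (Hom E e x) (m d x) (el z x)) =
          (\<lambda>d\<in>Obj D. \<lambda>x\<in>Obj E. compose (Hom E e x) (m d x) (el z' x))"
        by (auto simp: el_def compose_def fun_eq_iff)
      then have "el z = el z'"
        using el z by (intro inj_onD[OF bij_betw_imp_inj_on[OF bij]]) auto
      then have "el z e (Ident E e) = el z' e (Ident E e)" by simp
      then show "z = z'"
        using e z Ident_in_Hom[OF catE e] set_functor_Ident[OF catE L e] by (simp add: el_def)
    next
      fix y assume "y \<in> (\<lambda>z. \<lambda>d\<in>Obj D. m d e z) ` omap L e"
      then show "y \<in> matching D (value_at S e)" using nat_m(3) e by auto
    next
      fix y assume y: "y \<in> matching D (value_at S e)"
      define k where "k = (\<lambda>d\<in>Obj D. \<lambda>x\<in>Obj E. \<lambda>g\<in>Hom E e x. amap (omap S d) e x g (y d))"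
      have yd: "y d \<in> omap (omap S d) e" if "d \<in> Obj D" for d
        using y that by (auto simp: matching_def)
      have "k d \<in> set_nat E ?Y (omap S d)" if "d \<in> Obj D" for d
        using e that yd[OF that] set_functor_app[OF catE functor_at[OF that]]
          set_functor_Comp[OF catE functor_at[OF that]] Comp_in_Hom[OF catE]
        by (auto simp: k_def intro!: set_natI)
      moreover have "(\<lambda>d\<in>Obj D. k d x g) \<in> matching D (value_at S x)"
        if x: "x \<in> Obj E" and g: "g \<in> Hom E e x" for x g
      proof -
        have "amap S d' d f x (amap (omap S d') e x g (y d')) = amap (omap S d) e x g (y d)"
          if d: "d \<in> Obj D" "d' \<in> Obj D" "f \<in> Hom D d d'" for d d' f
          using set_nat_natural[OF transition[OF d] e x g yd[OF d(2)]] y d by (simp add: matching_def)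
        then show ?thesis
          using x g e yd set_functor_app[OF catE functor_at] by (auto simp: k_def matching_def)
      qed
      ultimately have "k \<in> cones (fun_cat E SET) D S ?Y"
        by (auto simp: cones_fun_cat[OF Y] PiE_iff k_def)
      then obtain h where h: "h \<in> set_nat E ?Y L"
          "k = (\<lambda>d\<in>Obj D. \<lambda>x\<in>Obj E. compose (Hom E e x) (m d x) (h x))"
        using bij unfolding bij_betw_def by blast
      have "h e (Ident E e) \<in> omap L e"
        using set_nat_app[OF h(1) e] Ident_in_Hom[OF catE e] by simp
      moreover have "m d e (h e (Ident E e)) = y d" if "d \<in> Obj D" for d
        using fun_cong[OF fun_cong[OF fun_cong[OF h(2), of d], of e], of "Ident E e"] that e
          Ident_in_Hom[OF catE e] set_functor_Ident[OF catE functor_at[OF that] e yd[OF that]]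
        by (simp add: k_def compose_def)
      then have "(\<lambda>d\<in>Obj D. m d e (h e (Ident E e))) = y"
        using y by (auto simp: matching_def PiE_iff intro!: extensionalityI[of _ "Obj D"])
      ultimately show "y \<in> (\<lambda>z. \<lambda>d\<in>Obj D. m d e z) ` omap L e" by blast
    qed
  qed
next
  note nat_m = cone_components[OF L m]
  assume r: ?r
  have inj: "z = z'" if "e \<in> Obj E" "z \<in> omap L e" "z' \<in> omap L e" "\<And>d. d \<in> Obj D \<Longrightarrow> m d e z = m d e z'"
    for e z z'
  proof -
    have "(\<lambda>d\<in>Obj D. m d e z) = (\<lambda>d\<in>Obj D. m d e z')" using that(4) by auto
    then show ?thesis using r that(1-3) by (auto simp: bij_betw_def inj_on_def)
  qed
  have "bij_betw (\<lambda>h. \<lambda>d\<in>Obj D. \<lambda>e\<in>Obj E. compose (omap X e) (m d e) (h e))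
      (set_nat E X L) (cones (fun_cat E SET) D S X)" if X: "is_functor E SET X" for X
    unfolding bij_betw_def
  proof (intro conjI inj_onI equalityI subsetI)
    fix h h' assume h: "h \<in> set_nat E X L" "h' \<in> set_nat E X L"
      and eq: "(\<lambda>d\<in>Obj D. \<lambda>e\<in>Obj E. compose (omap X e) (m d e) (h e)) =
        (\<lambda>d\<in>Obj D. \<lambda>e\<in>Obj E. compose (omap X e) (m d e) (h' e))"
    show "h = h'"
    proof (rule set_nat_eqI[OF h])
      fix e x assume ex: "e \<in> Obj E" "x \<in> omap X e"
      have "m d e (h e x) = m d e (h' e x)" if "d \<in> Obj D" for d
        using fun_cong[OF fun_cong[OF fun_cong[OF eq, of d], of e], of x] that ex
        by (simp add: compose_def)
      then show "h e x = h' e x" 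
        using inj[OF ex(1) set_nat_app[OF h(1) ex] set_nat_app[OF h(2) ex]] by blast
    qed
  next
    fix k assume "k \<in> (\<lambda>h. \<lambda>d\<in>Obj D. \<lambda>e\<in>Obj E. compose (omap X e) (m d e) (h e)) ` set_nat E X L"
    then obtain h where h: "h \<in> set_nat E X L"
      and k: "k = (\<lambda>d\<in>Obj D. \<lambda>e\<in>Obj E. compose (omap X e) (m d e) (h e))" by blast
    have "(\<lambda>d\<in>Obj D. k d e x) \<in> matching D (value_at S e)" if "e \<in> Obj E" "x \<in> omap X e" for e x
      using nat_m(3)[OF that(1) set_nat_app[OF h that]] that
      by (simp add: k compose_def cong: restrict_cong)
    moreover have "k d \<in> set_nat E X (omap S d)" if "d \<in> Obj D" for d
      using that set_nat_comp[OF h nat_m(1)[OF that] set_functor_arr[OF catE X]] by (simp add: k)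
    ultimately show "k \<in> cones (fun_cat E SET) D S X"
      by (auto simp: cones_fun_cat[OF X] PiE_iff k)
  next
    fix k assume k: "k \<in> cones (fun_cat E SET) D S X"
    note nat_k = cone_components[OF X k]
    have "\<forall>e\<in>Obj E. \<forall>x\<in>omap X e. \<exists>z\<in>omap L e. (\<lambda>d\<in>Obj D. k d e x) = (\<lambda>d\<in>Obj D. m d e z)"
      using nat_k(3) r unfolding bij_betw_def by blast
    then obtain h where h: "\<forall>e\<in>Obj E. \<forall>x\<in>omap X e.
        h e x \<in> omap L e \<and> (\<lambda>d\<in>Obj D. k d e x) = (\<lambda>d\<in>Obj D. m d e (h e x))" by metis
    have hk: "m d e (h e x) = k d e x" if "d \<in> Obj D" "e \<in> Obj E" "x \<in> omap X e" for d e x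
    proof -
      have "(\<lambda>d\<in>Obj D. k d e x) = (\<lambda>d\<in>Obj D. m d e (h e x))" using h that by blast
      from fun_cong[OF this, of d] show ?thesis using that(1) by simp
    qed
    let ?h = "\<lambda>e\<in>Obj E. \<lambda>x\<in>omap X e. h e x"
    have nat_h: "?h \<in> set_nat E X L"
    proof (rule set_natI)
      fix e e' f x assume *: "e \<in> Obj E" "e' \<in> Obj E" "f \<in> Hom E e e'" "x \<in> omap X e"
      have Xf: "amap X e e' f x \<in> omap X e'" using set_functor_app[OF catE X *] .
      have "h e' (amap X e e' f x) = amap L e e' f (h e x)"
      proof (rule inj[OF *(2)])
        show "h e' (amap X e e' f x) \<in> omap L e'" using h *(2) Xf by blast
        show "amap L e e' f (h e x) \<in> omap L e'" using set_functor_app[OF catE L *(1-3)] h * by blast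
        fix d assume d: "d \<in> Obj D"
        have "m d e' (h e' (amap X e e' f x)) = amap (omap S d) e e' f (k d e x)"
          using hk[OF d *(2) Xf] set_nat_natural[OF nat_k(1)[OF d] *] by simp
        also have "\<dots> = m d e' (amap L e e' f (h e x))"
          using hk[OF d *(1,4)] set_nat_natural[OF nat_m(1)[OF d] *(1-3), of "h e x"] h * by simp
        finally show "m d e' (h e' (amap X e e' f x)) = m d e' (amap L e e' f (h e x))" .
      qed
      then show "?h e' (amap X e e' f x) = amap L e e' f (?h e x)" using * Xf by simp
    qed (use h in auto)
    have "k = (\<lambda>d\<in>Obj D. \<lambda>e\<in>Obj E. compose (omap X e) (m d e) (?h e))"
    proof (rule extensionalityI[of _ "Obj D"])
      fix d assume d: "d \<in> Obj D"
      have "k d = (\<lambda>e\<in>Obj E. compose (omap X e) (m d e) (?h e))"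
        using set_nat_comp[OF nat_h nat_m(1)[OF d] set_functor_arr[OF catE X]] nat_k(1)[OF d]
        by (intro set_nat_eqI) (auto simp: compose_def hk d)
      then show "k d = (\<lambda>d\<in>Obj D. \<lambda>e\<in>Obj E. compose (omap X e) (m d e) (?h e)) d" using d by simp
    qed (use nat_k(2) in auto)
    then show "k \<in> (\<lambda>h. \<lambda>d\<in>Obj D. \<lambda>e\<in>Obj E. compose (omap X e) (m d e) (h e)) ` set_nat E X L"
      using nat_h by blast
  qed
  then show ?l using L m Hom_fun_cat_SET[OF catE _ L] unfolding is_lim_def by simp
qed

text \<open>
  The limit at \<open>e\<close> is the set of matching families at \<open>e\<close>. These are functions, so they are coded as
  elements of the universe type; that a code exists is a consequence of the strong limit property.
\<close>

lemma ex_lim: "\<exists>L m. is_lim (fun_cat E SET) D S L m"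
proof -
  let ?M = "\<lambda>e. matching D (value_at S e)"
  have "\<exists>enc :: ('u \<Rightarrow> 'u) \<Rightarrow> 'u. inj_on enc (?M e) \<and> small (enc ` ?M e)" if e: "e \<in> Obj E" for e
  proof -
    have "small (omap (omap S d) e)" if "d \<in> Obj D" for d
      using set_functor_small[OF catE functor_at[OF that] e] .
    then obtain enc :: "('u \<Rightarrow> 'u) \<Rightarrow> 'u" where enc: "inj_on enc (\<Pi>\<^sub>E d\<in>Obj D. omap (omap S d) e)"
        "small (enc ` (\<Pi>\<^sub>E d\<in>Obj D. omap (omap S d) e))"
      using D PiE_small_code[of "Obj D" "\<lambda>d. omap (omap S d) e"] unfolding small_category_def by blast
    have "?M e \<subseteq> (\<Pi>\<^sub>E d\<in>Obj D. omap (omap S d) e)" by (auto simp: matching_def)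
    then show ?thesis using enc inj_on_subset small_subset image_mono by metis
  qed
  then obtain enc :: "'u \<Rightarrow> ('u \<Rightarrow> 'u) \<Rightarrow> 'u" where
    enc: "\<And>e. e \<in> Obj E \<Longrightarrow> inj_on (enc e) (?M e)" "\<And>e. e \<in> Obj E \<Longrightarrow> small (enc e ` ?M e)" by metis
  define dec where "dec e = inv_into (?M e) (enc e)" for e
  have dec: "dec e (enc e y) = y" if "e \<in> Obj E" "y \<in> ?M e" for e y
    using enc that by (simp add: dec_def)
  define act where "act e e' g y = (\<lambda>d\<in>Obj D. amap (omap S d) e e' g (y d))" for e e' g and y :: "'u \<Rightarrow> 'u"
  have act: "act e e' g y \<in> ?M e'"
    if "e \<in> Obj E" "e' \<in> Obj E" "g \<in> Hom E e e'" "y \<in> ?M e" for e e' g y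
  proof -
    have yd: "y d \<in> omap (omap S d) e" if "d \<in> Obj D" for d
      using that \<open>y \<in> ?M e\<close> by (auto simp: matching_def)
    have "amap S d' d f e' (amap (omap S d') e e' g (y d')) = amap (omap S d) e e' g (y d)"
      if d: "d \<in> Obj D" "d' \<in> Obj D" "f \<in> Hom D d d'" for d d' f
      using set_nat_natural[OF transition[OF d] \<open>e \<in> Obj E\<close> \<open>e' \<in> Obj E\<close> \<open>g \<in> Hom E e e'\<close> yd[OF d(2)]]
        \<open>y \<in> ?M e\<close> d by (simp add: matching_def)
    then show ?thesis
      using yd that set_functor_app[OF catE functor_at] by (auto simp: act_def matching_def)
  qed
  define L where "L = \<lparr> omap = (\<lambda>e. enc e ` ?M e),
    amap = (\<lambda>e e' g. \<lambda>z\<in>enc e ` ?M e. enc e' (act e e' g (dec e z))) \<rparr>"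
  define m where "m = (\<lambda>d\<in>Obj D. \<lambda>e\<in>Obj E. \<lambda>z\<in>enc e ` ?M e. dec e z d)"
  have yd: "y d \<in> omap (omap S d) e" if "d \<in> Obj D" "y \<in> ?M e" for d y e
    using that by (auto simp: matching_def)
  have ext: "y \<in> extensional (Obj D)" if "y \<in> ?M e" for y e
    using that by (simp add: matching_def PiE_iff)
  have act_Ident: "act e e (Ident E e) y = y" if "e \<in> Obj E" "y \<in> ?M e" for e y
    using that yd ext[OF that(2)] set_functor_Ident[OF catE functor_at]
    by (auto simp: act_def intro!: extensionalityI[of _ "Obj D"])
  have act_Comp: "act x z (Comp E x y z g f) w = act y z g (act x y f w)"
    if "x \<in> Obj E" "y \<in> Obj E" "z \<in> Obj E" "f \<in> Hom E x y" "g \<in> Hom E y z" "w \<in> ?M x" for x y z f g w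
    using that yd set_functor_Comp[OF catE functor_at] by (auto simp: act_def)
  have L: "is_functor E SET L"
    unfolding set_functor_iff[OF catE]
    using enc(2) act Comp_in_Hom[OF catE] Ident_in_Hom[OF catE]
    by (auto simp: L_def dec act_Ident act_Comp)
  have "m d \<in> set_nat E L (omap S d)" if "d \<in> Obj D" for d
  proof (rule set_natI)
    fix e e' g z assume *: "e \<in> Obj E" "e' \<in> Obj E" "g \<in> Hom E e e'" and z: "z \<in> omap L e"
    obtain y where y: "y \<in> ?M e" "z = enc e y" using z by (auto simp: L_def)
    show "m d e' (amap L e e' g z) = amap (omap S d) e e' g (m d e z)"
      using that * y act[OF * y(1)] by (simp add: m_def L_def dec) (simp add: act_def)
  next
    fix e assume e: "e \<in> Obj E"
    then show "m d e \<in> omap L e \<rightarrow>\<^sub>E omap (omap S d) e"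
      using that yd by (auto simp: m_def L_def dec)
  qed (use that in \<open>simp add: m_def\<close>)
  moreover have dm: "(\<lambda>d\<in>Obj D. m d e z) = dec e z" if "e \<in> Obj E" "z \<in> enc e ` ?M e" for e z
    using that ext by (auto simp: m_def dec intro!: extensionalityI[of _ "Obj D"])
  ultimately have m: "m \<in> cones (fun_cat E SET) D S L"
    unfolding cones_fun_cat[OF L] by (auto simp: PiE_iff dm L_def dec) (simp add: m_def)
  have "bij_betw (\<lambda>z. \<lambda>d\<in>Obj D. m d e z) (omap L e) (?M e)" if "e \<in> Obj E" for e
  proof -
    have "bij_betw (dec e) (enc e ` ?M e) (?M e)"
      unfolding dec_def using enc(1)[OF that] by (simp add: bij_betw_inv_into inj_on_imp_bij_betw)
    moreover have "bij_betw (\<lambda>z. \<lambda>d\<in>Obj D. m d e z) (enc e ` ?M e) (?M e) \<longleftrightarrow>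
        bij_betw (dec e) (enc e ` ?M e) (?M e)"
      by (rule bij_betw_cong) (rule dm[OF that])
    ultimately show ?thesis by (simp add: L_def)
  qed
  then show ?thesis using is_lim_fun_cat_iff[OF L m] by blast
qed

end


section \<open>Weighted colimits of sets\<close>

text \<open>
  A weighted colimit of sets is the quotient of the set of triples \<open>(e, p, a)\<close>, with \<open>p\<close> in \<open>\<phi> e\<close>
  and \<open>a\<close> in \<open>F e\<close>, by the equivalence relation generated by \<open>(e, \<phi> f p, a) \<sim> (e', p, F f a)\<close>
  for \<open>f : e \<rightarrow> e'\<close> (the coend formula). It is also the set of connected components of the category of
  elements of \<open>F\<close> restricted to the category of elements of \<open>\<phi>\<close>; a zig-zag in this category is a
  chain of generating steps.
\<close>

definition triples :: "('u, 'u) cat \<Rightarrow> ('u, 'u set, 'u, 'u \<Rightarrow> 'u) fctr \<Rightarrow> ('u, 'u set, 'u, 'u \<Rightarrow> 'u) fctr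
    \<Rightarrow> ('u \<times> 'u \<times> 'u) set" where
  "triples E \<phi> F = {(e, p, a). e \<in> Obj E \<and> p \<in> omap \<phi> e \<and> a \<in> omap F e}"

definition triple_step :: "('u, 'u) cat \<Rightarrow> ('u, 'u set, 'u, 'u \<Rightarrow> 'u) fctr \<Rightarrow> ('u, 'u set, 'u, 'u \<Rightarrow> 'u) fctr
    \<Rightarrow> ('u \<times> 'u \<times> 'u) rel" where
  "triple_step E \<phi> F = {((e, amap \<phi> e' e f p, a), (e', p, amap F e e' f a)) | e e' f p a.
    e \<in> Obj E \<and> e' \<in> Obj E \<and> f \<in> Hom E e e' \<and> p \<in> omap \<phi> e' \<and> a \<in> omap F e}"

definition triple_equiv :: "('u, 'u) cat \<Rightarrow> ('u, 'u set, 'u, 'u \<Rightarrow> 'u) fctr \<Rightarrow> ('u, 'u set, 'u, 'u \<Rightarrow> 'u) fctr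
    \<Rightarrow> ('u \<times> 'u \<times> 'u) rel" where
  "triple_equiv E \<phi> F = (triple_step E \<phi> F \<union> (triple_step E \<phi> F)\<inverse>)\<^sup>*"

definition act_triple :: "('u \<Rightarrow> 'u \<Rightarrow> 'u) \<Rightarrow> 'u \<times> 'u \<times> 'u \<Rightarrow> 'u \<times> 'u \<times> 'u" where
  "act_triple \<tau> = (\<lambda>(e, p, a). (e, p, \<tau> e a))"

lemma act_triple_simp [simp]: "act_triple \<tau> (e, p, a) = (e, p, \<tau> e a)"
  by (simp add: act_triple_def)

lemma mem_triples [simp]: "(e, p, a) \<in> triples E \<phi> F \<longleftrightarrow> e \<in> Obj E \<and> p \<in> omap \<phi> e \<and> a \<in> omap F e"
  by (simp add: triples_def)

lemma triple_stepI: "\<lbrakk>e \<in> Obj E; e' \<in> Obj E; f \<in> Hom E e e'; p \<in> omap \<phi> e'; a \<in> omap F e\<rbrakk>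
    \<Longrightarrow> ((e, amap \<phi> e' e f p, a), (e', p, amap F e e' f a)) \<in> triple_step E \<phi> F"
  unfolding triple_step_def by blast

lemma triple_stepE:
  assumes "(t, t') \<in> triple_step E \<phi> F"
  obtains e e' f p a where "t = (e, amap \<phi> e' e f p, a)" "t' = (e', p, amap F e e' f a)"
    "e \<in> Obj E" "e' \<in> Obj E" "f \<in> Hom E e e'" "p \<in> omap \<phi> e'" "a \<in> omap F e"
  using assms unfolding triple_step_def by blast

lemma triple_equiv_refl [simp]: "(t, t) \<in> triple_equiv E \<phi> F"
  by (simp add: triple_equiv_def)

lemma triple_equiv_step: "(t, t') \<in> triple_step E \<phi> F \<Longrightarrow> (t, t') \<in> triple_equiv E \<phi> F"
  by (auto simp: triple_equiv_def)

lemma triple_equiv_sym: "(t, t') \<in> triple_equiv E \<phi> F \<Longrightarrow> (t', t) \<in> triple_equiv E \<phi> F"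
proof -
  have "sym (triple_equiv E \<phi> F)"
    unfolding triple_equiv_def by (intro sym_rtrancl) (auto simp: sym_def)
  then show "(t, t') \<in> triple_equiv E \<phi> F \<Longrightarrow> (t', t) \<in> triple_equiv E \<phi> F" by (rule symD)
qed

lemma triple_equiv_trans:
  "(t, t') \<in> triple_equiv E \<phi> F \<Longrightarrow> (t', t'') \<in> triple_equiv E \<phi> F \<Longrightarrow> (t, t'') \<in> triple_equiv E \<phi> F"
  by (auto simp: triple_equiv_def)

lemma triple_equiv_invariant:
  assumes "(t, t') \<in> triple_equiv E \<phi> F"
    and "\<And>t t'. (t, t') \<in> triple_step E \<phi> F \<Longrightarrow> u t = u t'"
  shows "u t = u t'"
  using assms(1) unfolding triple_equiv_def by (induction rule: rtrancl_induct) (auto dest: assms(2))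

lemma triple_equiv_map:
  assumes "(t, t') \<in> triple_equiv E \<phi> F"
    and "\<And>t t'. (t, t') \<in> triple_step E \<phi> F \<Longrightarrow> (g t, g t') \<in> triple_step E' \<phi>' F'"
  shows "(g t, g t') \<in> triple_equiv E' \<phi>' F'"
  using assms(1) unfolding triple_equiv_def[of E]
proof (induction rule: rtrancl_induct)
  case (step t' t'')
  have "(g t', g t'') \<in> triple_equiv E' \<phi>' F'"
    using step(2) by (auto intro: triple_equiv_step triple_equiv_sym assms(2))
  then show ?case using step(3) by (rule triple_equiv_trans[rotated])
qed simp

text \<open>
  The maps \<open>q e p\<close> exhibit \<open>Q\<close> as the quotient of the triples. By \<open>presentation_is_wcolim\<close> and
  \<open>wcolim_presents\<close> this is equivalent to the universal property, so it holds for every choice of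
  weighted colimits.
\<close>

definition presents_colim :: "('u, 'u) cat \<Rightarrow> ('u, 'u set, 'u, 'u \<Rightarrow> 'u) fctr \<Rightarrow> ('u, 'u set, 'u, 'u \<Rightarrow> 'u) fctr
    \<Rightarrow> 'u set \<Rightarrow> ('u \<Rightarrow> 'u \<Rightarrow> 'u \<Rightarrow> 'u) \<Rightarrow> bool" where
  "presents_colim E \<phi> F Q q \<longleftrightarrow> small Q \<and>
    q \<in> (\<Pi>\<^sub>E e\<in>Obj E. omap \<phi> e \<rightarrow>\<^sub>E omap F e \<rightarrow>\<^sub>E Q) \<and>
    Q \<subseteq> (\<lambda>(e, p, a). q e p a) ` triples E \<phi> F \<and>
    (\<forall>e p a e' p' a'. (e, p, a) \<in> triples E \<phi> F \<longrightarrow> (e', p', a') \<in> triples E \<phi> F \<longrightarrow>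
      (q e p a = q e' p' a' \<longleftrightarrow> ((e, p, a), (e', p', a')) \<in> triple_equiv E \<phi> F))"

lemma
  assumes Q: "presents_colim E \<phi> F Q q"
  shows presents_small: "small Q"
    and presents_arr: "q \<in> (\<Pi>\<^sub>E e\<in>Obj E. omap \<phi> e \<rightarrow>\<^sub>E omap F e \<rightarrow>\<^sub>E Q)"
    and presents_surj: "z \<in> Q \<Longrightarrow> \<exists>e p a. (e, p, a) \<in> triples E \<phi> F \<and> z = q e p a"
    and presents_eq: "(e, p, a) \<in> triples E \<phi> F \<Longrightarrow> (e', p', a') \<in> triples E \<phi> F \<Longrightarrow>
      q e p a = q e' p' a' \<longleftrightarrow> ((e, p, a), (e', p', a')) \<in> triple_equiv E \<phi> F"
proof -
  show "z \<in> Q \<Longrightarrow> \<exists>e p a. (e, p, a) \<in> triples E \<phi> F \<and> z = q e p a"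
    using Q unfolding presents_colim_def by fastforce
qed (use Q in \<open>simp_all add: presents_colim_def\<close>)

locale weight =
  fixes E :: "('u::universe, 'u) cat" and \<phi> :: "('u, 'u set, 'u, 'u \<Rightarrow> 'u) fctr"
  assumes weight: "is_weight (E, \<phi>)"
begin

lemma small_E: "small_category E" and E_category: "is_category E" and \<phi>: "is_functor (op_cat E) SET \<phi>"
  using weight by (auto simp: is_weight_def small_category_def)

lemma step_triples:
  assumes "is_functor E SET F" "(t, t') \<in> triple_step E \<phi> F"
  shows "t \<in> triples E \<phi> F" "t' \<in> triples E \<phi> F"
  using assms(2) set_functor_app[OF E_category assms(1)] presheaf_app[OF E_category \<phi>]
  by (auto elim!: triple_stepE)

lemma act_triple_in: "\<tau> \<in> set_nat E F G \<Longrightarrow> t \<in> triples E \<phi> F \<Longrightarrow> act_triple \<tau> t \<in> triples E \<phi> G"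
  by (cases t) (auto dest: set_nat_app)

lemma ex_presentation:
  assumes F: "is_functor E SET F"
  shows "\<exists>Q q. presents_colim E \<phi> F Q q"
proof -
  define code :: "'u \<times> 'u \<times> 'u \<Rightarrow> 'u" where "code = (\<lambda>(e, p, a). pair_code e (pair_code p a))"
  have code: "code t = code t' \<longleftrightarrow> t = t'" for t t' by (cases t; cases t') (simp add: code_def)
  \<comment> \<open>A class is coded by a chosen representative.\<close>
  define cls where "cls t = code (SOME t'. (t, t') \<in> triple_equiv E \<phi> F)" for t
  have cls: "cls t = cls t' \<longleftrightarrow> (t, t') \<in> triple_equiv E \<phi> F" for t t'
  proof
    have "(t, SOME t'. (t, t') \<in> triple_equiv E \<phi> F) \<in> triple_equiv E \<phi> F" for t
      by (rule someI[of "\<lambda>t'. (t, t') \<in> triple_equiv E \<phi> F" t]) simp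
    moreover assume "cls t = cls t'"
    ultimately show "(t, t') \<in> triple_equiv E \<phi> F"
      unfolding cls_def code by (metis triple_equiv_sym triple_equiv_trans)
  next
    assume "(t, t') \<in> triple_equiv E \<phi> F"
    then have "(\<lambda>t''. (t, t'') \<in> triple_equiv E \<phi> F) = (\<lambda>t''. (t', t'') \<in> triple_equiv E \<phi> F)"
      by (intro ext) (metis triple_equiv_sym triple_equiv_trans)
    then show "cls t = cls t'" by (simp add: cls_def)
  qed
  define Q where "Q = (\<Union>e\<in>Obj E. \<Union>p\<in>omap \<phi> e. (\<lambda>a. cls (e, p, a)) ` omap F e)"
  have "small (omap \<phi> e)" if "e \<in> Obj E" for e
    using set_functor_small[OF is_category_op[OF E_category] \<phi>] that by simp
  then have "small Q"
    unfolding Q_def using small_E set_functor_small[OF E_category F]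
    by (intro regular small_image) (auto simp: small_category_def)
  let ?q = "\<lambda>e\<in>Obj E. \<lambda>p\<in>omap \<phi> e. \<lambda>a\<in>omap F e. cls (e, p, a)"
  have "Q \<subseteq> (\<lambda>(e, p, a). ?q e p a) ` triples E \<phi> F"
  proof
    fix z assume "z \<in> Q"
    then obtain e p a where "e \<in> Obj E" "p \<in> omap \<phi> e" "a \<in> omap F e" "z = cls (e, p, a)"
      by (auto simp: Q_def)
    then show "z \<in> (\<lambda>(e, p, a). ?q e p a) ` triples E \<phi> F" by (intro image_eqI[of _ _ "(e, p, a)"]) auto
  qed
  then have "presents_colim E \<phi> F Q ?q"
    using \<open>small Q\<close> unfolding presents_colim_def by (simp add: cls PiE_iff) (auto simp: Q_def)
  then show ?thesis by blast
qed

text \<open>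
  A transformation from \<open>\<phi>\<close> to \<open>SET(F-, X)\<close> is, by currying, a function from the triples to \<open>X\<close> that
  is invariant under the generating steps.
\<close>

lemma set_nat_hom_to_iff:
  assumes F: "is_functor E SET F"
  shows "k \<in> set_nat (op_cat E) \<phi> (hom_to SET F X) \<longleftrightarrow>
    k \<in> (\<Pi>\<^sub>E e\<in>Obj E. omap \<phi> e \<rightarrow>\<^sub>E omap F e \<rightarrow>\<^sub>E X) \<and>
    (\<forall>e\<in>Obj E. \<forall>e'\<in>Obj E. \<forall>f\<in>Hom E e e'. \<forall>p\<in>omap \<phi> e'. \<forall>a\<in>omap F e.
      k e (amap \<phi> e' e f p) a = k e' p (amap F e e' f a))" (is "_ \<longleftrightarrow> ?P \<and> ?N")
proof -
  have *: "k e (amap \<phi> e' e f p) = amap (hom_to SET F X) e' e f (k e' p) \<longleftrightarrow>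
      (\<forall>a\<in>omap F e. k e (amap \<phi> e' e f p) a = k e' p (amap F e e' f a))"
    if P: ?P and *: "e \<in> Obj E" "e' \<in> Obj E" "f \<in> Hom E e e'" "p \<in> omap \<phi> e'" for e e' f p
  proof -
    have ext: "k e (amap \<phi> e' e f p) \<in> extensional (omap F e)"
      using P * presheaf_app[OF E_category \<phi> *] by (simp add: PiE_iff)
    have mem: "k e' p \<in> omap F e' \<rightarrow>\<^sub>E X" using P * by (simp add: PiE_iff)
    show ?thesis
    proof
      assume "k e (amap \<phi> e' e f p) = amap (hom_to SET F X) e' e f (k e' p)"
      then show "\<forall>a\<in>omap F e. k e (amap \<phi> e' e f p) a = k e' p (amap F e e' f a)"
        using mem by (simp add: compose_def)
    next
      assume "\<forall>a\<in>omap F e. k e (amap \<phi> e' e f p) a = k e' p (amap F e e' f a)"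
      then show "k e (amap \<phi> e' e f p) = amap (hom_to SET F X) e' e f (k e' p)"
        using mem by (auto simp: compose_def intro!: extensionalityI[OF ext])
    qed
  qed
  show ?thesis
    unfolding set_nat_def mem_Collect_eq op_cat_simps hom_to_simps(1) SET_simps(2)
  proof (rule conj_cong[OF refl])
    assume ?P
    show "(\<forall>x\<in>Obj E. \<forall>y\<in>Obj E. \<forall>f\<in>Hom E y x. \<forall>p\<in>omap \<phi> x.
        k y (amap \<phi> x y f p) = amap (hom_to SET F X) x y f (k x p)) \<longleftrightarrow> ?N"
      using *[OF \<open>?P\<close>] by blast
  qed
qed

lemma presentation_is_wcolim:
  assumes F: "is_functor E SET F" and Q: "presents_colim E \<phi> F Q q"
  shows "is_wcolim SET E \<phi> F Q q"
proof -
  note q = presents_arr[OF Q] and surj = presents_surj[OF Q] and eq = presents_eq[OF Q]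
    and sm = presents_small[OF Q]
  have qQ: "q e p a \<in> Q" if "(e, p, a) \<in> triples E \<phi> F" for e p a
    using q that by (auto simp: PiE_iff)
  have "q e (amap \<phi> e' e f p) a = q e' p (amap F e e' f a)"
    if *: "e \<in> Obj E" "e' \<in> Obj E" "f \<in> Hom E e e'" "p \<in> omap \<phi> e'" "a \<in> omap F e" for e e' f p a
    using eq[OF step_triples[OF F triple_stepI[OF *]]] triple_equiv_step[OF triple_stepI[OF *]] by simp
  then have nat: "q \<in> set_nat (op_cat E) \<phi> (hom_to SET F Q)"
    using q by (simp add: set_nat_hom_to_iff[OF F])
  have "bij_betw (\<lambda>h. \<lambda>e\<in>Obj E. \<lambda>p\<in>omap \<phi> e. compose (omap F e) h (q e p)) (Q \<rightarrow>\<^sub>E X)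
      (set_nat (op_cat E) \<phi> (hom_to SET F X))" for X
    unfolding bij_betw_def
  proof (intro conjI inj_onI equalityI subsetI)
    fix h h' assume h: "h \<in> Q \<rightarrow>\<^sub>E X" "h' \<in> Q \<rightarrow>\<^sub>E X"
      and hh: "(\<lambda>e\<in>Obj E. \<lambda>p\<in>omap \<phi> e. compose (omap F e) h (q e p)) =
        (\<lambda>e\<in>Obj E. \<lambda>p\<in>omap \<phi> e. compose (omap F e) h' (q e p))"
    show "h = h'"
    proof (rule PiE_ext[OF h])
      fix z assume "z \<in> Q"
      then obtain e p a where t: "(e, p, a) \<in> triples E \<phi> F" "z = q e p a" using surj by blast
      then show "h z = h' z"
        using fun_cong[OF fun_cong[OF fun_cong[OF hh, of e], of p], of a] by (simp add: compose_def)
    qed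
  next
    fix k assume "k \<in> (\<lambda>h. \<lambda>e\<in>Obj E. \<lambda>p\<in>omap \<phi> e. compose (omap F e) h (q e p)) ` (Q \<rightarrow>\<^sub>E X)"
    then obtain h where h: "h \<in> Q \<rightarrow>\<^sub>E X"
      and k: "k = (\<lambda>e\<in>Obj E. \<lambda>p\<in>omap \<phi> e. compose (omap F e) h (q e p))" by blast
    have "k e (amap \<phi> e' e f p) a = k e' p (amap F e e' f a)"
      if *: "e \<in> Obj E" "e' \<in> Obj E" "f \<in> Hom E e e'" "p \<in> omap \<phi> e'" "a \<in> omap F e" for e e' f p a
      using * nat presheaf_app[OF E_category \<phi> *(1-4)] set_functor_app[OF E_category F *(1-3,5)]
      by (simp add: k compose_def set_nat_hom_to_iff[OF F])
    then show "k \<in> set_nat (op_cat E) \<phi> (hom_to SET F X)"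
      unfolding set_nat_hom_to_iff[OF F] using h qQ by (auto simp: k compose_def)
  next
    fix k assume k: "k \<in> set_nat (op_cat E) \<phi> (hom_to SET F X)"
    note k' = k[unfolded set_nat_hom_to_iff[OF F]]
    have inv: "(\<lambda>(e, p, a). k e p a) t = (\<lambda>(e, p, a). k e p a) t'"
      if "(t, t') \<in> triple_equiv E \<phi> F" for t t'
      using that by (rule triple_equiv_invariant) (use k' in \<open>auto elim!: triple_stepE\<close>)
    define rep where "rep z = (SOME t. t \<in> triples E \<phi> F \<and> z = (\<lambda>(e, p, a). q e p a) t)" for z
    have rep: "rep z \<in> triples E \<phi> F \<and> z = (\<lambda>(e, p, a). q e p a) (rep z)" if "z \<in> Q" for z
      unfolding rep_def by (rule someI_ex) (use surj[OF that] in auto)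
    define h where "h = (\<lambda>z\<in>Q. (\<lambda>(e, p, a). k e p a) (rep z))"
    have hq: "h (q e p a) = k e p a" if t: "(e, p, a) \<in> triples E \<phi> F" for e p a
    proof -
      obtain e' p' a' where r: "rep (q e p a) = (e', p', a')" by (metis prod_cases3)
      then have "((e', p', a'), (e, p, a)) \<in> triple_equiv E \<phi> F"
        using rep[OF qQ[OF t]] eq[OF _ t, of e' p' a'] by simp
      from inv[OF this] show ?thesis using qQ[OF t] r by (simp add: h_def)
    qed
    have "h z \<in> X" if z: "z \<in> Q" for z
    proof -
      obtain e p a where t: "(e, p, a) \<in> triples E \<phi> F" "z = q e p a" using surj[OF z] by blast
      then show ?thesis using hq[OF t(1)] k' by (auto simp: PiE_iff)
    qed
    then have h: "h \<in> Q \<rightarrow>\<^sub>E X" by (simp add: h_def PiE_iff)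
    have "k = (\<lambda>e\<in>Obj E. \<lambda>p\<in>omap \<phi> e. compose (omap F e) h (q e p))"
    proof (intro ext)
      fix e p a
      show "k e p a = (\<lambda>e\<in>Obj E. \<lambda>p\<in>omap \<phi> e. compose (omap F e) h (q e p)) e p a"
        using k' hq[of e p a] by (auto simp: compose_def PiE_iff extensional_def restrict_def)
    qed
    then show "k \<in> (\<lambda>h. \<lambda>e\<in>Obj E. \<lambda>p\<in>omap \<phi> e. compose (omap F e) h (q e p)) ` (Q \<rightarrow>\<^sub>E X)"
      using h by blast
  qed
  then show ?thesis unfolding is_wcolim_def using sm nat by simp
qed

lemma wcolim_factor:
  assumes Q: "is_wcolim SET E \<phi> F Q q"
    and X: "small (X :: 'u set)" and k: "k \<in> set_nat (op_cat E) \<phi> (hom_to SET F X)"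
  shows "\<exists>h\<in>Q \<rightarrow>\<^sub>E X. \<forall>(e, p, a)\<in>triples E \<phi> F. h (q e p a) = k e p a"
proof -
  have "bij_betw (\<lambda>h. \<lambda>e\<in>Obj E. \<lambda>p\<in>omap \<phi> e. compose (omap F e) h (q e p)) (Q \<rightarrow>\<^sub>E X)
      (set_nat (op_cat E) \<phi> (hom_to SET F X))"
    using Q X by (simp add: is_wcolim_def)
  then obtain h where h: "h \<in> Q \<rightarrow>\<^sub>E X"
      "k = (\<lambda>e\<in>Obj E. \<lambda>p\<in>omap \<phi> e. compose (omap F e) h (q e p))"
    using k unfolding bij_betw_def by blast
  have "\<forall>(e, p, a)\<in>triples E \<phi> F. h (q e p a) = k e p a" by (auto simp: h(2) compose_def)
  then show ?thesis using h(1) by blast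
qed

lemma wcolim_unique:
  assumes Q: "is_wcolim SET E \<phi> F Q q" and X: "small (X :: 'u set)"
    and h: "h \<in> Q \<rightarrow>\<^sub>E X" "h' \<in> Q \<rightarrow>\<^sub>E X"
    and eq: "\<And>e p a. (e, p, a) \<in> triples E \<phi> F \<Longrightarrow> h (q e p a) = h' (q e p a)"
  shows "h = h'"
proof -
  have "bij_betw (\<lambda>h. \<lambda>e\<in>Obj E. \<lambda>p\<in>omap \<phi> e. compose (omap F e) h (q e p)) (Q \<rightarrow>\<^sub>E X)
      (set_nat (op_cat E) \<phi> (hom_to SET F X))"
    using Q X by (simp add: is_wcolim_def)
  moreover have "(\<lambda>e\<in>Obj E. \<lambda>p\<in>omap \<phi> e. compose (omap F e) h (q e p)) =
      (\<lambda>e\<in>Obj E. \<lambda>p\<in>omap \<phi> e. compose (omap F e) h' (q e p))"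
    using eq by (auto simp: fun_eq_iff compose_def)
  ultimately show ?thesis using h by (auto simp: bij_betw_def inj_on_def)
qed

text \<open>
  Being the quotient of the triples transports along the isomorphism with the colimit constructed
  in \<open>ex_presentation\<close>.
\<close>

lemma wcolim_presents:
  assumes F: "is_functor E SET F" and Q: "is_wcolim SET E \<phi> F Q q"
  shows "presents_colim E \<phi> F Q q"
proof -
  obtain Q0 q0 where P0: "presents_colim E \<phi> F Q0 q0" using ex_presentation[OF F] by blast
  note Q0 = presentation_is_wcolim[OF F P0]
  have nat: "q \<in> set_nat (op_cat E) \<phi> (hom_to SET F Q)" "q0 \<in> set_nat (op_cat E) \<phi> (hom_to SET F Q0)"
    and sm: "small Q" "small Q0"
    using Q Q0 by (auto simp: is_wcolim_def)
  note nat' = nat[unfolded set_nat_hom_to_iff[OF F]]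
  obtain h where h: "h \<in> Q \<rightarrow>\<^sub>E Q0" "\<And>e p a. (e, p, a) \<in> triples E \<phi> F \<Longrightarrow> h (q e p a) = q0 e p a"
    using wcolim_factor[OF Q sm(2) nat(2)] by blast
  obtain k where k: "k \<in> Q0 \<rightarrow>\<^sub>E Q" "\<And>e p a. (e, p, a) \<in> triples E \<phi> F \<Longrightarrow> k (q0 e p a) = q e p a"
    using wcolim_factor[OF Q0 sm(1) nat(1)] by blast
  have qQ: "q e p a \<in> Q" if "(e, p, a) \<in> triples E \<phi> F" for e p a
    using nat'(1) that by (auto simp: PiE_iff)
  have kh: "compose Q k h = (\<lambda>z\<in>Q. z)"
    by (rule wcolim_unique[OF Q sm(1)]) (use h k qQ in \<open>auto simp: compose_def\<close>)
  have "Q \<subseteq> (\<lambda>(e, p, a). q e p a) ` triples E \<phi> F"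
  proof
    fix z assume z: "z \<in> Q"
    then have "h z \<in> Q0" using h(1) by auto
    then obtain e p a where t: "(e, p, a) \<in> triples E \<phi> F" "h z = q0 e p a"
      using presents_surj[OF P0] by blast
    have "z = k (h z)" using fun_cong[OF kh, of z] z by (simp add: compose_def)
    then have "z = q e p a" unfolding t(2) k(2)[OF t(1)] .
    then show "z \<in> (\<lambda>(e, p, a). q e p a) ` triples E \<phi> F"
      using t(1) by (intro image_eqI[of _ _ "(e, p, a)"]) auto
  qed
  moreover have "q e p a = q e' p' a' \<longleftrightarrow> q0 e p a = q0 e' p' a'"
    if "(e, p, a) \<in> triples E \<phi> F" "(e', p', a') \<in> triples E \<phi> F" for e p a e' p' a'
    using h(2) k(2) that by metis
  ultimately show ?thesis using P0 nat'(1) sm(1) unfolding presents_colim_def by simp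
qed

text \<open>
  The class of a triple in the chosen colimit. From here on the functor \<open>\<phi> \<star> (-)\<close> is only used through
  the properties of \<open>iota\<close>: its image, its kernel, and its naturality.
\<close>

definition iota :: "('u, 'u set, 'u, 'u \<Rightarrow> 'u) fctr \<Rightarrow> 'u \<times> 'u \<times> 'u \<Rightarrow> 'u" where
  "iota F = (\<lambda>(e, p, a). snd (star_colim E \<phi> F) e p a)"

lemma star_is_wcolim:
  assumes F: "is_functor E SET F"
  shows "is_wcolim SET E \<phi> F (omap (star E \<phi>) F) (snd (star_colim E \<phi> F))"
proof -
  have "\<exists>Qq. (\<lambda>(Q, q). is_wcolim SET E \<phi> F Q q) Qq"
    using ex_presentation[OF F] presentation_is_wcolim[OF F] by auto
  then have "(\<lambda>(Q, q). is_wcolim SET E \<phi> F Q q) (star_colim E \<phi> F)"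
    unfolding star_colim_def by (rule someI_ex)
  then show ?thesis by (simp add: star_def case_prod_unfold)
qed

lemma
  assumes F: "is_functor E SET F"
  shows star_small: "small (omap (star E \<phi>) F)"
    and iota_in: "t \<in> triples E \<phi> F \<Longrightarrow> iota F t \<in> omap (star E \<phi>) F"
    and iota_surj: "z \<in> omap (star E \<phi>) F \<Longrightarrow> \<exists>t\<in>triples E \<phi> F. z = iota F t"
    and iota_eq: "t \<in> triples E \<phi> F \<Longrightarrow> t' \<in> triples E \<phi> F \<Longrightarrow>
      iota F t = iota F t' \<longleftrightarrow> (t, t') \<in> triple_equiv E \<phi> F"
proof -
  note P = wcolim_presents[OF F star_is_wcolim[OF F], unfolded presents_colim_def]
  show "small (omap (star E \<phi>) F)" using P by blast
  show "t \<in> triples E \<phi> F \<Longrightarrow> iota F t \<in> omap (star E \<phi>) F"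
    using P by (cases t) (auto simp: iota_def PiE_iff)
  show "z \<in> omap (star E \<phi>) F \<Longrightarrow> \<exists>t\<in>triples E \<phi> F. z = iota F t"
    using P unfolding iota_def by blast
  show "t \<in> triples E \<phi> F \<Longrightarrow> t' \<in> triples E \<phi> F \<Longrightarrow>
      iota F t = iota F t' \<longleftrightarrow> (t, t') \<in> triple_equiv E \<phi> F"
    using P unfolding iota_def by (cases t; cases t') simp
qed

lemma star_amap:
  assumes F: "is_functor E SET F" and G: "is_functor E SET G" and \<tau>: "\<tau> \<in> set_nat E F G"
  shows "amap (star E \<phi>) F G \<tau> \<in> omap (star E \<phi>) F \<rightarrow>\<^sub>E omap (star E \<phi>) G" (is ?A)
    and "t \<in> triples E \<phi> F \<Longrightarrow> amap (star E \<phi>) F G \<tau> (iota F t) = iota G (act_triple \<tau> t)"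
proof -
  let ?q = "snd (star_colim E \<phi> F)" and ?r = "snd (star_colim E \<phi> G)"
  let ?Q = "omap (star E \<phi>) F" and ?R = "omap (star E \<phi>) G"
  let ?P = "\<lambda>h. h \<in> ?Q \<rightarrow>\<^sub>E ?R \<and>
    (\<forall>e\<in>Obj E. \<forall>p\<in>omap \<phi> e. compose (omap F e) h (?q e p) = compose (omap F e) (?r e p) (\<tau> e))"
  have P_iff: "?P h \<longleftrightarrow> h \<in> ?Q \<rightarrow>\<^sub>E ?R \<and> (\<forall>t\<in>triples E \<phi> F. h (iota F t) = iota G (act_triple \<tau> t))" for h
    unfolding compose_def by (auto simp: iota_def fun_eq_iff restrict_def triples_def)
  let ?k = "\<lambda>e\<in>Obj E. \<lambda>p\<in>omap \<phi> e. \<lambda>a\<in>omap F e. iota G (e, p, \<tau> e a)"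
  have "iota G (e, amap \<phi> e' e f p, \<tau> e a) = iota G (e', p, \<tau> e' (amap F e e' f a))"
    if *: "e \<in> Obj E" "e' \<in> Obj E" "f \<in> Hom E e e'" "p \<in> omap \<phi> e'" "a \<in> omap F e" for e e' f p a
  proof -
    note s = triple_stepI[OF *(1-4) set_nat_app[OF \<tau> *(1,5)]]
    show ?thesis
      using iota_eq[OF G step_triples[OF G s]] triple_equiv_step[OF s] set_nat_natural[OF \<tau> *(1-3,5)] by simp
  qed
  then have "?k \<in> set_nat (op_cat E) \<phi> (hom_to SET F ?R)"
    unfolding set_nat_hom_to_iff[OF F]
    using iota_in[OF G] set_nat_app[OF \<tau>] presheaf_app[OF E_category \<phi>] set_functor_app[OF E_category F]
    by auto
  then obtain h where "h \<in> ?Q \<rightarrow>\<^sub>E ?R" "\<forall>(e, p, a)\<in>triples E \<phi> F. h (?q e p a) = ?k e p a"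
    using wcolim_factor[OF star_is_wcolim[OF F] star_small[OF G], of ?k] by blast
  then have "?P h" unfolding P_iff by (auto simp: iota_def triples_def)
  then have "\<exists>h. ?P h" by blast
  moreover have "h = h'" if P: "?P h" "?P h'" for h h'
  proof (rule wcolim_unique[OF star_is_wcolim[OF F] star_small[OF G]])
    fix e p a assume t: "(e, p, a) \<in> triples E \<phi> F"
    then have "h (iota F (e, p, a)) = h' (iota F (e, p, a))" using P unfolding P_iff by simp
    then show "h (?q e p a) = h' (?q e p a)" by (simp add: iota_def)
  qed (use P in auto)
  ultimately have "\<exists>!h. ?P h" by blast
  then have "?P (THE h. ?P h)" by (rule theI')
  moreover have "amap (star E \<phi>) F G \<tau> = (THE h. ?P h)" by (simp add: star_def)
  ultimately have "?P (amap (star E \<phi>) F G \<tau>)" by simp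
  then show ?A and "t \<in> triples E \<phi> F \<Longrightarrow> amap (star E \<phi>) F G \<tau> (iota F t) = iota G (act_triple \<tau> t)"
    unfolding P_iff by blast+
qed

end

text \<open>
  The comparison from the colimit of a limit to the limit of the colimits is injective and
  surjective, in terms of representatives.
\<close>

definition limit_commutes ::
    "('u, 'u) cat \<Rightarrow> ('u, 'u set, 'u, 'u \<Rightarrow> 'u) fctr \<Rightarrow> ('u, 'u) cat
      \<Rightarrow> ('u, ('u, 'u set, 'u, 'u \<Rightarrow> 'u) fctr, 'u, 'u \<Rightarrow> 'u \<Rightarrow> 'u) fctr
      \<Rightarrow> ('u, 'u set, 'u, 'u \<Rightarrow> 'u) fctr \<Rightarrow> ('u \<Rightarrow> 'u \<Rightarrow> 'u \<Rightarrow> 'u) \<Rightarrow> bool" where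
  "limit_commutes E \<phi> D S L m \<longleftrightarrow>
    (\<forall>t\<in>triples E \<phi> L. \<forall>t'\<in>triples E \<phi> L.
      (\<forall>d\<in>Obj D. (act_triple (m d) t, act_triple (m d) t') \<in> triple_equiv E \<phi> (omap S d)) \<longrightarrow>
      (t, t') \<in> triple_equiv E \<phi> L) \<and>
    (\<forall>s. (\<forall>d\<in>Obj D. s d \<in> triples E \<phi> (omap S d)) \<longrightarrow>
      (\<forall>d\<in>Obj D. \<forall>d'\<in>Obj D. \<forall>f\<in>Hom D d d'.
        (act_triple (amap S d' d f) (s d'), s d) \<in> triple_equiv E \<phi> (omap S d)) \<longrightarrow>
      (\<exists>t\<in>triples E \<phi> L. \<forall>d\<in>Obj D. (act_triple (m d) t, s d) \<in> triple_equiv E \<phi> (omap S d)))"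

locale weighted_diagram = weight E \<phi> + diagram D E S for D and E :: "('u::universe, 'u) cat" and S \<phi>
begin

lemma star_preserves_iff:
  assumes L: "is_functor E SET L" and m: "m \<in> cones (fun_cat E SET) D S L"
  shows "is_lim SET D (comp_fctr (star E \<phi>) S) (omap (star E \<phi>) L)
      (\<lambda>d\<in>Obj D. amap (star E \<phi>) L (omap S d) (m d)) \<longleftrightarrow> limit_commutes E \<phi> D S L m"
proof -
  note nat_m = cone_components[OF L m]
  let ?G = "comp_fctr (star E \<phi>) S" and ?n = "\<lambda>d\<in>Obj D. amap (star E \<phi>) L (omap S d) (m d)"
  have G: "amap ?G d' d f \<in> omap ?G d' \<rightarrow> omap ?G d" if d: "d \<in> Obj D" "d' \<in> Obj D" "f \<in> Hom D d d'" for d d' f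
    using star_amap(1)[OF functor_at[OF d(2)] functor_at[OF d(1)] transition[OF d]] by auto
  have G_iota: "amap ?G d' d f (iota (omap S d') t) = iota (omap S d) (act_triple (amap S d' d f) t)"
    if d: "d \<in> Obj D" "d' \<in> Obj D" "f \<in> Hom D d d'" and t: "t \<in> triples E \<phi> (omap S d')" for d d' f t
    using star_amap(2)[OF functor_at[OF d(2)] functor_at[OF d(1)] transition[OF d] t] by simp
  have n_iota: "?n d (iota L t) = iota (omap S d) (act_triple (m d) t)"
    if "d \<in> Obj D" "t \<in> triples E \<phi> L" for d t
    using star_amap(2)[OF L functor_at[OF that(1)] nat_m(1)[OF that(1)] that(2)] that(1) by simp
  have mt: "act_triple (m d) t \<in> triples E \<phi> (omap S d)" if "d \<in> Obj D" "t \<in> triples E \<phi> L" for d t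
    using act_triple_in[OF nat_m(1)[OF that(1)] that(2)] .
  have C: "k \<in> cones SET D ?G X \<longleftrightarrow> k \<in> (\<Pi>\<^sub>E d\<in>Obj D. X \<rightarrow>\<^sub>E omap ?G d) \<and>
    (\<forall>x\<in>X. (\<lambda>d\<in>Obj D. k d x) \<in> matching D ?G)" for k X
    by (rule cones_SET) (rule G)
  have comm: "act_triple (amap S d' d f) (act_triple (m d') t) = act_triple (m d) t"
    if "d \<in> Obj D" "d' \<in> Obj D" "f \<in> Hom D d d'" "t \<in> triples E \<phi> L" for d d' f t
    using that nat_m(4) by (cases t) auto
  have n: "?n \<in> cones SET D ?G (omap (star E \<phi>) L)"
  proof -
    have "(\<lambda>d\<in>Obj D. ?n d z) \<in> matching D ?G" if z: "z \<in> omap (star E \<phi>) L" for z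
    proof -
      obtain t where t: "t \<in> triples E \<phi> L" "z = iota L t" using iota_surj[OF L z] by blast
      have "amap ?G d' d f (?n d' z) = ?n d z" if d: "d \<in> Obj D" "d' \<in> Obj D" "f \<in> Hom D d d'" for d d' f
        unfolding t(2) n_iota[OF d(1) t(1)] n_iota[OF d(2) t(1)] G_iota[OF d mt[OF d(2) t(1)]]
          comm[OF d t(1)] ..
      moreover have "?n d z \<in> omap ?G d" if d: "d \<in> Obj D" for d
        using iota_in[OF functor_at[OF d] mt[OF d t(1)]] unfolding t(2) n_iota[OF d t(1)] by simp
      ultimately show ?thesis by (simp add: matching_def PiE_iff)
    qed
    then show ?thesis
      unfolding C using star_amap(1)[OF L functor_at nat_m(1)] by (auto simp: PiE_iff)
  qed
  have "is_lim SET D ?G (omap (star E \<phi>) L) ?n \<longleftrightarrow>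
      bij_betw (\<lambda>z. \<lambda>d\<in>Obj D. ?n d z) (omap (star E \<phi>) L) (matching D ?G)"
    by (rule is_lim_SET_iff[OF _ star_small[OF L] n]) (rule G)
  also have "\<dots> \<longleftrightarrow> limit_commutes E \<phi> D S L m"
  proof
    assume bij: "bij_betw (\<lambda>z. \<lambda>d\<in>Obj D. ?n d z) (omap (star E \<phi>) L) (matching D ?G)"
    show "limit_commutes E \<phi> D S L m"
      unfolding limit_commutes_def
    proof (intro conjI ballI allI impI)
      fix t t' assume t: "t \<in> triples E \<phi> L" "t' \<in> triples E \<phi> L"
        and *: "\<forall>d\<in>Obj D. (act_triple (m d) t, act_triple (m d) t') \<in> triple_equiv E \<phi> (omap S d)"
      have "?n d (iota L t) = ?n d (iota L t')" if d: "d \<in> Obj D" for d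
        unfolding n_iota[OF d t(1)] n_iota[OF d t(2)]
        using * d iota_eq[OF functor_at[OF d] mt[OF d t(1)] mt[OF d t(2)]] by blast
      then have "(\<lambda>d\<in>Obj D. ?n d (iota L t)) = (\<lambda>d\<in>Obj D. ?n d (iota L t'))" by (rule restrict_ext)
      then have "iota L t = iota L t'"
        using inj_onD[OF bij_betw_imp_inj_on[OF bij]] iota_in[OF L t(1)] iota_in[OF L t(2)] by blast
      then show "(t, t') \<in> triple_equiv E \<phi> L" using iota_eq[OF L t] by blast
    next
      fix s assume s: "\<forall>d\<in>Obj D. s d \<in> triples E \<phi> (omap S d)"
        and *: "\<forall>d\<in>Obj D. \<forall>d'\<in>Obj D. \<forall>f\<in>Hom D d d'.
          (act_triple (amap S d' d f) (s d'), s d) \<in> triple_equiv E \<phi> (omap S d)"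
      let ?y = "\<lambda>d\<in>Obj D. iota (omap S d) (s d)"
      have "amap ?G d' d f (?y d') = ?y d" if d: "d \<in> Obj D" "d' \<in> Obj D" "f \<in> Hom D d d'" for d d' f
      proof -
        have sd: "s d \<in> triples E \<phi> (omap S d)" "s d' \<in> triples E \<phi> (omap S d')" using s d by auto
        have "amap ?G d' d f (iota (omap S d') (s d')) = iota (omap S d) (s d)"
          unfolding G_iota[OF d sd(2)] iota_eq[OF functor_at[OF d(1)] act_triple_in[OF transition[OF d] sd(2)] sd(1)]
          using * d by blast
        then show ?thesis using d by simp
      qed
      moreover have "?y d \<in> omap ?G d" if "d \<in> Obj D" for d
        using iota_in[OF functor_at[OF that]] s that by simp
      ultimately have "?y \<in> matching D ?G" by (simp add: matching_def PiE_iff)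
      then have "?y \<in> (\<lambda>z. \<lambda>d\<in>Obj D. ?n d z) ` omap (star E \<phi>) L"
        using bij_betw_imp_surj_on[OF bij] by simp
      then obtain z where z: "z \<in> omap (star E \<phi>) L" "?y = (\<lambda>d\<in>Obj D. ?n d z)" by (rule imageE)
      obtain t where t: "t \<in> triples E \<phi> L" "z = iota L t" using iota_surj[OF L z(1)] by blast
      have "(act_triple (m d) t, s d) \<in> triple_equiv E \<phi> (omap S d)" if d: "d \<in> Obj D" for d
      proof -
        have "?n d z = iota (omap S d) (s d)" using fun_cong[OF z(2), of d] d by simp
        then have "iota (omap S d) (act_triple (m d) t) = iota (omap S d) (s d)"
          unfolding t(2) n_iota[OF d t(1)] .
        then show ?thesis using iota_eq[OF functor_at[OF d] mt[OF d t(1)]] s d by blast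
      qed
      then show "\<exists>t\<in>triples E \<phi> L. \<forall>d\<in>Obj D. (act_triple (m d) t, s d) \<in> triple_equiv E \<phi> (omap S d)"
        using t(1) by blast
    qed
  next
    assume comm: "limit_commutes E \<phi> D S L m"
    show "bij_betw (\<lambda>z. \<lambda>d\<in>Obj D. ?n d z) (omap (star E \<phi>) L) (matching D ?G)"
      unfolding bij_betw_def
    proof (intro conjI inj_onI equalityI subsetI)
      fix z z' assume z: "z \<in> omap (star E \<phi>) L" "z' \<in> omap (star E \<phi>) L"
        and eq: "(\<lambda>d\<in>Obj D. ?n d z) = (\<lambda>d\<in>Obj D. ?n d z')"
      obtain t where t: "t \<in> triples E \<phi> L" "z = iota L t" using iota_surj[OF L z(1)] by blast
      obtain t' where t': "t' \<in> triples E \<phi> L" "z' = iota L t'" using iota_surj[OF L z(2)] by blast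
      have "(act_triple (m d) t, act_triple (m d) t') \<in> triple_equiv E \<phi> (omap S d)" if d: "d \<in> Obj D" for d
      proof -
        have "?n d z = ?n d z'" using fun_cong[OF eq, of d] d by simp
        then show ?thesis
          unfolding t(2) t'(2) n_iota[OF d t(1)] n_iota[OF d t'(1)]
          using iota_eq[OF functor_at[OF d] mt[OF d t(1)] mt[OF d t'(1)]] by blast
      qed
      then have "(t, t') \<in> triple_equiv E \<phi> L"
        using comm t(1) t'(1) unfolding limit_commutes_def by blast
      then show "z = z'" unfolding t(2) t'(2) using iota_eq[OF L t(1) t'(1)] by blast
    next
      fix y assume "y \<in> (\<lambda>z. \<lambda>d\<in>Obj D. ?n d z) ` omap (star E \<phi>) L"
      then obtain z where z: "z \<in> omap (star E \<phi>) L" "y = (\<lambda>d\<in>Obj D. ?n d z)" by (rule imageE)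
      show "y \<in> matching D ?G" unfolding z(2) by (rule bspec[OF conjunct2[OF n[unfolded C]] z(1)])
    next
      fix y assume y: "y \<in> matching D ?G"
      then have "\<forall>d\<in>Obj D. \<exists>t\<in>triples E \<phi> (omap S d). y d = iota (omap S d) t"
        using iota_surj[OF functor_at] by (auto simp: matching_def PiE_iff)
      then obtain s where s: "\<forall>d\<in>Obj D. s d \<in> triples E \<phi> (omap S d) \<and> y d = iota (omap S d) (s d)" by metis
      have "(act_triple (amap S d' d f) (s d'), s d) \<in> triple_equiv E \<phi> (omap S d)"
        if d: "d \<in> Obj D" "d' \<in> Obj D" "f \<in> Hom D d d'" for d d' f
      proof -
        have sd: "s d \<in> triples E \<phi> (omap S d)" "s d' \<in> triples E \<phi> (omap S d')"
          and yd: "y d = iota (omap S d) (s d)" "y d' = iota (omap S d') (s d')" using s d by auto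
        have "amap ?G d' d f (y d') = y d" using y d unfolding matching_def by blast
        then show ?thesis
          unfolding yd G_iota[OF d sd(2)]
            iota_eq[OF functor_at[OF d(1)] act_triple_in[OF transition[OF d] sd(2)] sd(1)] .
      qed
      then obtain t where t: "t \<in> triples E \<phi> L"
          "\<forall>d\<in>Obj D. (act_triple (m d) t, s d) \<in> triple_equiv E \<phi> (omap S d)"
        using comm s unfolding limit_commutes_def by blast
      have "?n d (iota L t) = y d" if d: "d \<in> Obj D" for d
        unfolding n_iota[OF d t(1)] using s t(2) d iota_eq[OF functor_at[OF d] mt[OF d t(1)]] by simp
      then have "(\<lambda>d\<in>Obj D. ?n d (iota L t)) = (\<lambda>d\<in>Obj D. y d)" by (rule restrict_ext)
      also have "\<dots> = y" using y by (simp add: matching_def PiE_iff extensional_restrict)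
      finally have "y = (\<lambda>d\<in>Obj D. ?n d (iota L t))" by simp
      then show "y \<in> (\<lambda>z. \<lambda>d\<in>Obj D. ?n d z) ` omap (star E \<phi>) L"
        using iota_in[OF L t(1)] by (rule image_eqI)
    qed
  qed
  finally show ?thesis .
qed

lemma preserves_iff_commutes:
  "preserves_wlim (fun_cat E SET) SET (star E \<phi>) D const1 S \<longleftrightarrow>
    (\<forall>L m. is_lim (fun_cat E SET) D S L m \<longrightarrow> limit_commutes E \<phi> D S L m)"
proof -
  have "is_functor E SET L \<and> m \<in> cones (fun_cat E SET) D S L" if "is_lim (fun_cat E SET) D S L m" for L m
    using that by (simp add: is_lim_def)
  then show ?thesis unfolding preserves_wlim_const1_iff using star_preserves_iff by blast
qed

end


section \<open>Limits of representables and cocones\<close>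

lemma weight_const1:
  assumes "small_category E"
  shows "weight E const1"
proof -
  have E: "is_category (op_cat E)" using assms is_category_op by (auto simp: small_category_def)
  have "is_functor (op_cat E) SET const1"
    unfolding set_functor_iff[OF E] by (auto simp: small_singleton)
  then show ?thesis using assms by (simp add: weight_def is_weight_def)
qed

text \<open>
  This is the co-Yoneda lemma: \<open>(e, p, h) \<mapsto> \<phi> h p\<close> induces a bijection from the colimit of \<open>E(x, -)\<close>
  weighted by \<open>\<phi>\<close> to \<open>\<phi> x\<close>.
\<close>

lemma (in weight) representable_equiv_iff:
  assumes x: "x \<in> Obj E"
    and t: "(e, p, h) \<in> triples E \<phi> (omap (yoneda E) x)" "(e', p', h') \<in> triples E \<phi> (omap (yoneda E) x)"
  shows "((e, p, h), (e', p', h')) \<in> triple_equiv E \<phi> (omap (yoneda E) x) \<longleftrightarrow>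
    amap \<phi> e x h p = amap \<phi> e' x h' p'"
proof
  let ?u = "\<lambda>(e, p, h). amap \<phi> e x h p"
  assume "((e, p, h), (e', p', h')) \<in> triple_equiv E \<phi> (omap (yoneda E) x)"
  then have "?u (e, p, h) = ?u (e', p', h')"
  proof (rule triple_equiv_invariant)
    fix t t' assume "(t, t') \<in> triple_step E \<phi> (omap (yoneda E) x)"
    then show "?u t = ?u t'"
      using x presheaf_Comp[OF E_category \<phi>] by (auto elim!: triple_stepE)
  qed
  then show "amap \<phi> e x h p = amap \<phi> e' x h' p'" by simp
next
  \<comment> \<open>Every triple is equivalent to one at the universal element: \<open>h\<close> itself gives a step.\<close>
  have *: "((x, amap \<phi> e x h p, Ident E x), (e, p, h)) \<in> triple_equiv E \<phi> (omap (yoneda E) x)"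
    if "(e, p, h) \<in> triples E \<phi> (omap (yoneda E) x)" for e p h
  proof -
    have e: "e \<in> Obj E" "p \<in> omap \<phi> e" "h \<in> Hom E x e" using that by auto
    show ?thesis
      using triple_stepI[of x E e h p \<phi> "Ident E x" "omap (yoneda E) x"] x e Ident_in_Hom[OF E_category x]
        Comp_Ident_right[OF E_category x e(1,3)]
      by (intro triple_equiv_step) simp
  qed
  assume "amap \<phi> e x h p = amap \<phi> e' x h' p'"
  then show "((e, p, h), (e', p', h')) \<in> triple_equiv E \<phi> (omap (yoneda E) x)"
    using *[OF t(1)] *[OF t(2)] triple_equiv_sym triple_equiv_trans by metis
qed

abbreviation representables :: "('u, 'u) cat \<Rightarrow> ('u, 'u, 'u, 'u) fctr
    \<Rightarrow> ('u, ('u, 'u set, 'u, 'u \<Rightarrow> 'u) fctr, 'u, 'u \<Rightarrow> 'u \<Rightarrow> 'u) fctr" where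
  "representables E T \<equiv> comp_fctr (yoneda E) (op_fctr T)"

lemma
  assumes "is_functor D E T"
  shows functor_omap: "d \<in> Obj D \<Longrightarrow> omap T d \<in> Obj E"
    and functor_amap: "\<lbrakk>d \<in> Obj D; d' \<in> Obj D; f \<in> Hom D d d'\<rbrakk>
      \<Longrightarrow> amap T d d' f \<in> Hom E (omap T d) (omap T d')"
    and functor_Ident: "d \<in> Obj D \<Longrightarrow> amap T d d (Ident D d) = Ident E (omap T d)"
    and functor_Comp: "\<lbrakk>x \<in> Obj D; y \<in> Obj D; z \<in> Obj D; f \<in> Hom D x y; g \<in> Hom D y z\<rbrakk>
      \<Longrightarrow> amap T x z (Comp D x y z g f) =
        Comp E (omap T x) (omap T y) (omap T z) (amap T y z g) (amap T x y f)"
  using assms unfolding is_functor_def by blast+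

lemma functor_representables:
  assumes D: "small_category D" and E: "small_category E" and T: "is_functor D E T"
  shows "is_functor (op_cat D) (fun_cat E SET) (representables E T)"
proof -
  have catD: "is_category D" and catE: "is_category E" using D E by (auto simp: small_category_def)
  note T' = functor_omap[OF T] functor_amap[OF T]
  have "(\<lambda>x\<in>Obj E. \<lambda>h\<in>Hom E (omap T d') x. Comp E (omap T d) (omap T d') x h (amap T d d' f))
      \<in> set_nat E (omap (yoneda E) (omap T d')) (omap (yoneda E) (omap T d))"
    if d: "d \<in> Obj D" "d' \<in> Obj D" "f \<in> Hom D d d'" for d d' f
    using T'(1)[OF d(1)] T'(1)[OF d(2)] T'(2)[OF d] Comp_in_Hom[OF catE] Comp_assoc[OF catE]
    by (intro set_natI) auto
  then show ?thesis
    unfolding fun_cat_functor_iff[OF is_category_op[OF catD] catE]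
    using functor_yoneda[OF E] T' Comp_Ident_right[OF catE] Comp_assoc[OF catE] Comp_in_Hom[OF catE]
    by (simp add: functor_Ident[OF T] functor_Comp[OF T])
qed

lemma mem_cocone_cat:
  "(e, c) \<in> Obj (cocone_cat D E T) \<longleftrightarrow> e \<in> Obj E \<and> c \<in> (\<Pi>\<^sub>E d\<in>Obj D. Hom E (omap T d) e) \<and>
    (\<forall>d\<in>Obj D. \<forall>d'\<in>Obj D. \<forall>f\<in>Hom D d d'.
      Comp E (omap T d) (omap T d') e (c d') (amap T d d' f) = c d)"
  by (simp add: cocone_cat_def)

lemma Hom_cocone_cat:
  "Hom (cocone_cat D E T) (e, c) (e', c') =
    {h \<in> Hom E e e'. \<forall>d\<in>Obj D. Comp E (omap T d) e e' h (c d) = c' d}"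
  by (simp add: cocone_cat_def)

text \<open>
  The limit \<open>L\<close> of the representables \<open>E(T d, -)\<close> sends an object \<open>e\<close> to the set of cocones from \<open>T\<close>
  to \<open>e\<close>.
\<close>

locale cocone_limit = weight E \<phi> for E :: "('u::universe, 'u) cat" and \<phi> +
  fixes D T L m
  assumes D: "small_category D" and T: "is_functor D E T"
    and lim: "is_lim (fun_cat E SET) D (representables E T) L m"
begin

sublocale weighted_diagram D E "representables E T" \<phi>
  by unfold_locales (use small_E D functor_representables[OF D small_E T] in auto)

lemma L: "is_functor E SET L" and m: "m \<in> cones (fun_cat E SET) D (representables E T) L"
  using lim by (auto simp: is_lim_def)

definition cocone :: "'u \<Rightarrow> 'u \<Rightarrow> 'u \<Rightarrow> 'u" where
  "cocone e z = (\<lambda>d\<in>Obj D. m d e z)"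

lemma bij_cocone:
  assumes e: "e \<in> Obj E"
  shows "bij_betw (cocone e) (omap L e) {c. (e, c) \<in> Obj (cocone_cat D E T)}"
proof -
  have "matching D (value_at (representables E T) e) = {c. (e, c) \<in> Obj (cocone_cat D E T)}"
    using e by (auto simp: matching_def mem_cocone_cat)
  moreover have "bij_betw (cocone e) (omap L e) (matching D (value_at (representables E T) e))"
    using lim e unfolding is_lim_fun_cat_iff[OF L m] cocone_def by blast
  ultimately show ?thesis by simp
qed

lemma cocone_in: "e \<in> Obj E \<Longrightarrow> z \<in> omap L e \<Longrightarrow> (e, cocone e z) \<in> Obj (cocone_cat D E T)"
  using bij_betwE[OF bij_cocone] by blast

lemma cocone_surj:
  "(e, c) \<in> Obj (cocone_cat D E T) \<Longrightarrow> \<exists>z\<in>omap L e. c = cocone e z"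
  using bij_betw_imp_surj_on[OF bij_cocone, of e] by (auto simp: mem_cocone_cat[of e c])

lemma cocone_inj:
  "\<lbrakk>e \<in> Obj E; z \<in> omap L e; z' \<in> omap L e; cocone e z = cocone e z'\<rbrakk> \<Longrightarrow> z = z'"
  using inj_onD[OF bij_betw_imp_inj_on[OF bij_cocone]] by blast

lemma leg_in_Hom: "\<lbrakk>d \<in> Obj D; e \<in> Obj E; z \<in> omap L e\<rbrakk> \<Longrightarrow> m d e z \<in> Hom E (omap T d) e"
  using cocone_in[of e z] by (auto simp: mem_cocone_cat cocone_def)

lemma leg_natural:
  "\<lbrakk>d \<in> Obj D; e \<in> Obj E; e' \<in> Obj E; f \<in> Hom E e e'; z \<in> omap L e\<rbrakk>
    \<Longrightarrow> m d e' (amap L e e' f z) = Comp E (omap T d) e e' f (m d e z)"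
  using set_nat_natural[OF cone_components(1)[OF L m, of d], of e e' f z] leg_in_Hom[of d e z] by simp

text \<open>
  By injectivity of \<open>cocone e'\<close>, the element \<open>z'\<close> has to be the image of \<open>z\<close> under \<open>g\<close>, so a morphism of cocones
  is a generating step, and zig-zags of cocones yield equal elements of the colimit.
\<close>

lemma cocone_morphism_equiv:
  assumes e: "e \<in> Obj E" "e' \<in> Obj E" and z: "z \<in> omap L e" "z' \<in> omap L e'"
    and g: "g \<in> Hom (cocone_cat D E T) (e, cocone e z) (e', cocone e' z')" and p: "p \<in> omap \<phi> e'"
  shows "((e, amap \<phi> e' e g p, z), (e', p, z')) \<in> triple_equiv E \<phi> L"
proof -
  have g': "g \<in> Hom E e e'" "\<And>d. d \<in> Obj D \<Longrightarrow> Comp E (omap T d) e e' g (m d e z) = m d e' z'"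
    using g by (auto simp: Hom_cocone_cat cocone_def)
  have "cocone e' (amap L e e' g z) = cocone e' z'"
    unfolding cocone_def using leg_natural[OF _ e g'(1) z(1)] g'(2) by (intro restrict_ext) simp
  then have "amap L e e' g z = z'"
    using cocone_inj[OF e(2)] set_functor_app[OF E_category L e g'(1) z(1)] z(2) by blast
  then show ?thesis using triple_stepI[OF e g'(1) p z(1)] by (auto intro: triple_equiv_step)
qed

end

text \<open>
  For the conical weight the colimit of a representable has one element, so the limit over \<open>D\<close> of these
  colimits has one element as well; the comparison map is bijective when the
  category of cocones has exactly one component.
\<close>

lemma connected_cocones_preserves_representables:
  fixes E :: "('u::universe, 'u) cat"
  assumes E: "small_category E" and D: "small_category D" and T: "is_functor D E T"
    and ne: "nonempty_cat (cocone_cat D E T)" and conn: "connected_cat (cocone_cat D E T)"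
  shows "preserves_wlim (fun_cat E SET) SET (star E const1) D const1 (representables E T)"
proof -
  interpret weight E const1 using E by (rule weight_const1)
  interpret weighted_diagram D E "representables E T" const1
    by unfold_locales (use D E functor_representables[OF D E T] in auto)
  show ?thesis unfolding preserves_iff_commutes
  proof (intro allI impI)
    fix L m assume "is_lim (fun_cat E SET) D (representables E T) L m"
    then interpret cocone_limit E const1 D T L m by unfold_locales (use D T in auto)
    have all: "((e, undefined, h), (e', undefined, h')) \<in> triple_equiv E const1 (omap (yoneda E) (omap T d))"
      if "d \<in> Obj D" "e \<in> Obj E" "e' \<in> Obj E" "h \<in> Hom E (omap T d) e" "h' \<in> Hom E (omap T d) e'"
      for d e e' h h'
      using that functor_omap[OF T] representable_equiv_iff[of "omap T d" e undefined h e' undefined h'] by simp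
    \<comment> \<open>Zig-zags of cocones become zig-zags of triples, because \<open>L\<close> classifies cocones.\<close>
    have linked: "((e, undefined, z), (e', undefined, z')) \<in> triple_equiv E const1 L"
      if e: "e \<in> Obj E" "e' \<in> Obj E" and z: "z \<in> omap L e" "z' \<in> omap L e'" for e e' z z'
    proof -
      have "((e, cocone e z), (e', cocone e' z')) \<in> {(a, b). a \<in> Obj (cocone_cat D E T) \<and>
          b \<in> Obj (cocone_cat D E T) \<and>
          (Hom (cocone_cat D E T) a b \<noteq> {} \<or> Hom (cocone_cat D E T) b a \<noteq> {})}\<^sup>*"
        using conn cocone_in[OF e(1) z(1)] cocone_in[OF e(2) z(2)] unfolding connected_cat_def by blast
      then have "\<forall>w\<in>omap L (fst (e', cocone e' z')). cocone (fst (e', cocone e' z')) w = snd (e', cocone e' z')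
          \<longrightarrow> ((e, undefined, z), (fst (e', cocone e' z'), undefined, w)) \<in> triple_equiv E const1 L"
      proof (induction rule: rtrancl_induct)
        case base
        have "\<forall>w\<in>omap L e. cocone e w = cocone e z \<longrightarrow> w = z"
          using cocone_inj[OF e(1) _ z(1)] by blast
        then show ?case by (metis fst_conv snd_conv triple_equiv_refl)
      next
        case (step x y)
        show ?case
        proof (intro ballI impI)
          fix w assume w: "w \<in> omap L (fst y)" "cocone (fst y) w = snd y"
          obtain x1 x2 y1 y2 where xy: "x = (x1, x2)" "y = (y1, y2)" by fastforce
          obtain v where v: "v \<in> omap L x1" "x2 = cocone x1 v"
            using cocone_surj[of x1 x2] step(2) xy by auto
          have o: "x1 \<in> Obj E" "y1 \<in> Obj E" using step(2) xy by (auto simp: mem_cocone_cat)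
          have "((x1, undefined, v), (y1, undefined, w)) \<in> triple_equiv E const1 L"
          proof (cases "Hom (cocone_cat D E T) x y = {}")
            case True
            then obtain g where "g \<in> Hom (cocone_cat D E T) (y1, cocone y1 w) (x1, cocone x1 v)"
              using step(2) xy v w by auto
            then show ?thesis
              using cocone_morphism_equiv[OF o(2,1) _ v(1), of w g undefined] w xy by (auto dest: triple_equiv_sym)
          next
            case False
            then obtain g where "g \<in> Hom (cocone_cat D E T) (x1, cocone x1 v) (y1, cocone y1 w)"
              using xy v w by auto
            then show ?thesis
              using cocone_morphism_equiv[OF o v(1), of w g undefined] w xy by auto
          qed
          moreover have "((e, undefined, z), (x1, undefined, v)) \<in> triple_equiv E const1 L"
            using step(3) v xy by auto
          ultimately show "((e, undefined, z), (fst y, undefined, w)) \<in> triple_equiv E const1 L"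
            using triple_equiv_trans xy by (metis fst_conv)
        qed
      qed
      then show ?thesis using z by simp
    qed
    obtain e0 c0 where "(e0, c0) \<in> Obj (cocone_cat D E T)"
      using ne unfolding nonempty_cat_def by fast
    then obtain z0 where z0: "e0 \<in> Obj E" "z0 \<in> omap L e0"
      using cocone_surj[of e0 c0] by (auto simp: mem_cocone_cat)
    show "limit_commutes E const1 D (representables E T) L m"
      unfolding limit_commutes_def
    proof (intro conjI ballI allI impI)
      fix t t' assume "t \<in> triples E const1 L" "t' \<in> triples E const1 L"
      then show "(t, t') \<in> triple_equiv E const1 L" by (cases t; cases t') (auto intro: linked)
    next
      fix s assume s: "\<forall>d\<in>Obj D. s d \<in> triples E const1 (omap (representables E T) d)"
      have "(act_triple (m d) (e0, undefined, z0), s d)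
          \<in> triple_equiv E const1 (omap (representables E T) d)" if d: "d \<in> Obj D" for d
      proof -
        obtain e p h where sd: "s d = (e, p, h)" by (metis prod_cases3)
        then have "e \<in> Obj E" "p = undefined" "h \<in> Hom E (omap T d) e" using s d by (auto dest!: bspec[of _ _ d])
        then show ?thesis using all[OF d z0(1) _ leg_in_Hom[OF d z0]] by (simp add: sd)
      qed
      then show "\<exists>t\<in>triples E const1 L. \<forall>d\<in>Obj D. (act_triple (m d) t, s d)
          \<in> triple_equiv E const1 (omap (representables E T) d)"
        using z0 by (intro bexI[of _ "(e0, undefined, z0)"]) auto
    qed
  qed
qed


section \<open>The category of elements of a weight\<close>

text \<open>
  An object \<open>(e, p)\<close> is coded as \<open>pair_code e p\<close>. Since hom-sets need not be disjoint, an arrow is just an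
  arrow of \<open>E\<close>; the source element is the restriction of the target element along it.
\<close>

definition elements :: "('u::universe, 'u) cat \<Rightarrow> ('u, 'u set, 'u, 'u \<Rightarrow> 'u) fctr \<Rightarrow> ('u, 'u) cat" where
  "elements E \<phi> =
    \<lparr> Obj = {pair_code e p | e p. e \<in> Obj E \<and> p \<in> omap \<phi> e},
      Hom = (\<lambda>a b. {f \<in> Hom E (fst_code a) (fst_code b).
        amap \<phi> (fst_code b) (fst_code a) f (snd_code b) = snd_code a}),
      Ident = (\<lambda>a. Ident E (fst_code a)),
      Comp = (\<lambda>a b c. Comp E (fst_code a) (fst_code b) (fst_code c)) \<rparr>"

definition elements_proj :: "('u::universe, 'u, 'u, 'u) fctr" where
  "elements_proj = \<lparr> omap = fst_code, amap = (\<lambda>a b f. f) \<rparr>"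

lemma elements_proj_simps [simp]:
  "omap elements_proj a = fst_code a" "amap elements_proj a b f = f"
  by (simp_all add: elements_proj_def)

lemma elements_simps [simp]:
  "Hom (elements E \<phi>) a b = {f \<in> Hom E (fst_code a) (fst_code b).
    amap \<phi> (fst_code b) (fst_code a) f (snd_code b) = snd_code a}"
  "Ident (elements E \<phi>) a = Ident E (fst_code a)"
  "Comp (elements E \<phi>) a b c = Comp E (fst_code a) (fst_code b) (fst_code c)"
  by (simp_all add: elements_def)

lemma pair_code_elements [simp]:
  "pair_code e p \<in> Obj (elements E \<phi>) \<longleftrightarrow> e \<in> Obj E \<and> p \<in> omap \<phi> e"
  by (auto simp: elements_def)

lemma Obj_elementsE:
  assumes "a \<in> Obj (elements E \<phi>)"
  obtains e p where "a = pair_code e p" "e \<in> Obj E" "p \<in> omap \<phi> e"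
  using assms by (auto simp: elements_def)

lemma Obj_elementsD:
  "a \<in> Obj (elements E \<phi>) \<Longrightarrow> fst_code a \<in> Obj E"
  "a \<in> Obj (elements E \<phi>) \<Longrightarrow> snd_code a \<in> omap \<phi> (fst_code a)"
  "a \<in> Obj (elements E \<phi>) \<Longrightarrow> pair_code (fst_code a) (snd_code a) = a"
  by (auto elim!: Obj_elementsE)

text \<open>
  The triples for \<open>\<phi>\<close> and \<open>F\<close> correspond to those for the conical weight on the category of elements,
  whose middle component is the unique element \<open>undefined\<close> of the value of \<open>const1\<close>.
\<close>

definition lift_triple :: "'u::universe \<times> 'u \<times> 'u \<Rightarrow> 'u \<times> 'u \<times> 'u" where
  "lift_triple = (\<lambda>(e, p, a). (pair_code e p, undefined, a))"

definition unlift_triple :: "'u::universe \<times> 'u \<times> 'u \<Rightarrow> 'u \<times> 'u \<times> 'u" where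
  "unlift_triple = (\<lambda>(b, u, a). (fst_code b, snd_code b, a))"

lemma unlift_lift [simp]: "unlift_triple (lift_triple t) = t"
  by (cases t) (simp add: lift_triple_def unlift_triple_def)

context weight
begin

abbreviation "El \<equiv> elements E \<phi>"

lemma category_elements: "is_category El"
  unfolding is_category_def
  using Obj_elementsD[where E = E and \<phi> = \<phi>] Ident_in_Hom[OF E_category] Comp_in_Hom[OF E_category]
    Comp_Ident_left[OF E_category] Comp_Ident_right[OF E_category] Comp_assoc[OF E_category]
    presheaf_Ident[OF E_category \<phi>] presheaf_Comp[OF E_category \<phi>]
  by simp

lemma small_elements: "small_category El"
proof -
  have "Obj El = (\<Union>e\<in>Obj E. pair_code e ` omap \<phi> e)" by (auto simp: elements_def)
  then have "small (Obj El)"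
    using small_E set_functor_small[OF is_category_op[OF E_category] \<phi>]
    by (auto simp: small_category_def intro!: regular small_image)
  moreover have "small (Hom El a b)" if "a \<in> Obj El" "b \<in> Obj El" for a b
    using small_E Obj_elementsD(1)[OF that(1)] Obj_elementsD(1)[OF that(2)]
    unfolding small_category_def by (auto intro: small_subset[of "Hom E (fst_code a) (fst_code b)"])
  ultimately show ?thesis using category_elements by (simp add: small_category_def)
qed

lemma functor_elements:
  assumes F: "is_functor E SET F"
  shows "is_functor El SET (comp_fctr F elements_proj)"
  unfolding set_functor_iff[OF category_elements]
  using Obj_elementsD(1)[where E = E and \<phi> = \<phi>] set_functor_small[OF E_category F]
    set_functor_arr[OF E_category F] set_functor_Ident[OF E_category F] set_functor_Comp[OF E_category F]
  by simp

lemma lift_in_iff: "lift_triple t \<in> triples El const1 (comp_fctr F elements_proj) \<longleftrightarrow> t \<in> triples E \<phi> F"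
  by (cases t) (simp add: lift_triple_def)

lemma lift_unlift: "t \<in> triples El const1 (comp_fctr F elements_proj) \<Longrightarrow> lift_triple (unlift_triple t) = t"
  by (cases t) (auto simp: lift_triple_def unlift_triple_def elim!: Obj_elementsE)

lemma lift_equiv_iff:
  "(lift_triple t, lift_triple t') \<in> triple_equiv El const1 (comp_fctr F elements_proj) \<longleftrightarrow>
    (t, t') \<in> triple_equiv E \<phi> F"
proof
  assume "(t, t') \<in> triple_equiv E \<phi> F"
  then show "(lift_triple t, lift_triple t') \<in> triple_equiv El const1 (comp_fctr F elements_proj)"
  proof (rule triple_equiv_map)
    fix t t' assume "(t, t') \<in> triple_step E \<phi> F"
    then obtain e e' f p a where *: "t = (e, amap \<phi> e' e f p, a)" "t' = (e', p, amap F e e' f a)"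
      "e \<in> Obj E" "e' \<in> Obj E" "f \<in> Hom E e e'" "p \<in> omap \<phi> e'" "a \<in> omap F e" by (rule triple_stepE)
    then show "(lift_triple t, lift_triple t') \<in> triple_step El const1 (comp_fctr F elements_proj)"
      using triple_stepI[of "pair_code e (amap \<phi> e' e f p)" El "pair_code e' p" f undefined const1 a
          "comp_fctr F elements_proj"] presheaf_app[OF E_category \<phi> *(3-6)]
      by (simp add: lift_triple_def)
  qed
next
  assume "(lift_triple t, lift_triple t') \<in> triple_equiv El const1 (comp_fctr F elements_proj)"
  then have "(unlift_triple (lift_triple t), unlift_triple (lift_triple t')) \<in> triple_equiv E \<phi> F"
  proof (rule triple_equiv_map)
    fix t t' assume "(t, t') \<in> triple_step El const1 (comp_fctr F elements_proj)"
    then obtain e e' f p a where *: "t = (e, amap const1 e' e f p, a)"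
      "t' = (e', p, amap (comp_fctr F elements_proj) e e' f a)" "e \<in> Obj El" "e' \<in> Obj El" "f \<in> Hom El e e'"
      "p \<in> omap const1 e'" "a \<in> omap (comp_fctr F elements_proj) e" by (rule triple_stepE)
    then show "(unlift_triple t, unlift_triple t') \<in> triple_step E \<phi> F"
      using triple_stepI[of "fst_code e" E "fst_code e'" f "snd_code e'" \<phi> a F]
        Obj_elementsD[OF *(3)] Obj_elementsD[OF *(4)]
      by (simp add: unlift_triple_def)
  qed
  then show "(t, t') \<in> triple_equiv E \<phi> F" by simp
qed

end

text \<open>
  A \<open>\<phi>\<close>-weighted colimit is a conical colimit over the category of elements, and restriction
  along the projection of the category of elements preserves the limits.
\<close>

lemma (in weighted_diagram) elements_preserves_imp_preserves:
  assumes pres: "\<And>S'. is_functor (op_cat D) (fun_cat El SET) S' \<Longrightarrow>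
      preserves_wlim (fun_cat El SET) SET (star El const1) D const1 S'"
  shows "preserves_wlim (fun_cat E SET) SET (star E \<phi>) D const1 S"
  unfolding preserves_iff_commutes
proof (intro allI impI)
  fix L m assume lim: "is_lim (fun_cat E SET) D S L m"
  then have L: "is_functor E SET L" and m: "m \<in> cones (fun_cat E SET) D S L" by (auto simp: is_lim_def)
  note nat_m = cone_components[OF L m]
  define whisker :: "('u \<Rightarrow> 'u \<Rightarrow> 'u) \<Rightarrow> 'u \<Rightarrow> 'u \<Rightarrow> 'u" where
    "whisker \<tau> = (\<lambda>b\<in>Obj El. \<tau> (fst_code b))" for \<tau>
  let ?r = "\<lambda>F. comp_fctr F elements_proj"
  define S' where "S' = \<lparr> omap = (\<lambda>d. ?r (omap S d)), amap = (\<lambda>d d' f. whisker (amap S d d' f)) \<rparr>"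
  define m' where "m' = (\<lambda>d\<in>Obj D. whisker (m d))"
  have S'_simps [simp]: "omap S' d = ?r (omap S d)" "amap S' d d' f = whisker (amap S d d' f)" for d d' f
    by (simp_all add: S'_def)
  have nat: "whisker \<tau> \<in> set_nat El (?r F) (?r G)" if \<tau>: "\<tau> \<in> set_nat E F G" for \<tau> F G
    using set_nat_arr[OF \<tau>] set_nat_natural[OF \<tau>] Obj_elementsD(1)[of _ E \<phi>]
    by (intro set_natI) (auto simp: whisker_def)
  have act: "act_triple (whisker \<tau>) (lift_triple t) = lift_triple (act_triple \<tau> t)"
    if "t \<in> triples E \<phi> F" for \<tau> t F
    using that by (cases t) (simp add: lift_triple_def whisker_def)
  have S': "is_functor (op_cat D) (fun_cat El SET) S'"
    unfolding fun_cat_functor_iff[OF is_category_op[OF catD] category_elements]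
    using S[unfolded fun_cat_functor_iff[OF is_category_op[OF catD] catE]] Obj_elementsD(1)[of _ E \<phi>]
    by (simp add: functor_elements functor_at nat transition) (simp add: whisker_def)
  interpret on_El: weight El const1 using small_elements by (rule weight_const1)
  interpret on_El: weighted_diagram D El S' const1
    by unfold_locales (use D small_elements S' in auto)
  have match: "matching D (value_at S' b) = matching D (value_at S (fst_code b))" if "b \<in> Obj El" for b
    using that by (simp add: matching_def whisker_def)
  have m'_eq: "(\<lambda>d\<in>Obj D. m' d b z) = (\<lambda>d\<in>Obj D. m d (fst_code b) z)" if "b \<in> Obj El" for b z
    using that by (auto simp: m'_def whisker_def)
  have m': "m' \<in> cones (fun_cat El SET) D S' (?r L)"
    unfolding on_El.cones_fun_cat[OF functor_elements[OF L]]
    using nat_m(3) nat[OF nat_m(1)] Obj_elementsD(1)[of _ E \<phi>] by (simp add: m'_eq match) (simp add: m'_def)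
  have "is_lim (fun_cat El SET) D S' (?r L) m'"
    unfolding on_El.is_lim_fun_cat_iff[OF functor_elements[OF L] m']
    using lim[unfolded is_lim_fun_cat_iff[OF L m]] Obj_elementsD(1)[of _ E \<phi>] by (simp add: m'_eq match)
  then have comm: "limit_commutes El const1 D S' (?r L) m'"
    using pres[OF S'] unfolding on_El.preserves_iff_commutes by blast
  have act_m': "act_triple (m' d) (lift_triple t) = lift_triple (act_triple (m d) t)"
    if "d \<in> Obj D" "t \<in> triples E \<phi> L" for d t
    using act[OF that(2)] that(1) by (simp add: m'_def)
  show "limit_commutes E \<phi> D S L m"
    unfolding limit_commutes_def
  proof (intro conjI ballI allI impI)
    fix t t' assume t: "t \<in> triples E \<phi> L" "t' \<in> triples E \<phi> L"
      and *: "\<forall>d\<in>Obj D. (act_triple (m d) t, act_triple (m d) t') \<in> triple_equiv E \<phi> (omap S d)"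
    have "\<forall>d\<in>Obj D. (act_triple (m' d) (lift_triple t), act_triple (m' d) (lift_triple t'))
        \<in> triple_equiv El const1 (omap S' d)"
      using * t by (simp add: act_m' lift_equiv_iff)
    then have "(lift_triple t, lift_triple t') \<in> triple_equiv El const1 (?r L)"
      using comm t lift_in_iff unfolding limit_commutes_def by blast
    then show "(t, t') \<in> triple_equiv E \<phi> L" by (simp add: lift_equiv_iff)
  next
    fix s assume s: "\<forall>d\<in>Obj D. s d \<in> triples E \<phi> (omap S d)"
      and *: "\<forall>d\<in>Obj D. \<forall>d'\<in>Obj D. \<forall>f\<in>Hom D d d'.
        (act_triple (amap S d' d f) (s d'), s d) \<in> triple_equiv E \<phi> (omap S d)"
    have "\<forall>d\<in>Obj D. lift_triple (s d) \<in> triples El const1 (omap S' d)"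
      using s by (simp add: lift_in_iff)
    moreover have "\<forall>d\<in>Obj D. \<forall>d'\<in>Obj D. \<forall>f\<in>Hom D d d'.
        (act_triple (amap S' d' d f) (lift_triple (s d')), lift_triple (s d)) \<in> triple_equiv El const1 (omap S' d)"
    proof (intro ballI)
      fix d d' f assume d: "d \<in> Obj D" "d' \<in> Obj D" "f \<in> Hom D d d'"
      then have "s d' \<in> triples E \<phi> (omap S d')" using s by blast
      from act[OF this] show "(act_triple (amap S' d' d f) (lift_triple (s d')), lift_triple (s d))
          \<in> triple_equiv El const1 (omap S' d)"
        using * d by (simp add: lift_equiv_iff)
    qed
    ultimately obtain t where t: "t \<in> triples El const1 (?r L)"
      "\<forall>d\<in>Obj D. (act_triple (m' d) t, lift_triple (s d)) \<in> triple_equiv El const1 (omap S' d)"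
      using comm[unfolded limit_commutes_def, THEN conjunct2, THEN spec, of "\<lambda>d. lift_triple (s d)"] by blast
    have u: "unlift_triple t \<in> triples E \<phi> L"
      using t(1) lift_unlift[OF t(1)] lift_in_iff[of "unlift_triple t" L] by simp
    have "(act_triple (m d) (unlift_triple t), s d) \<in> triple_equiv E \<phi> (omap S d)" if d: "d \<in> Obj D" for d
    proof -
      have "(act_triple (m' d) t, lift_triple (s d)) \<in> triple_equiv El const1 (?r (omap S d))"
        using t(2) d by simp
      moreover have "act_triple (m' d) t = lift_triple (act_triple (m d) (unlift_triple t))"
        using act_m'[OF d u] lift_unlift[OF t(1)] by simp
      ultimately show ?thesis by (simp add: lift_equiv_iff)
    qed
    then show "\<exists>t\<in>triples E \<phi> L. \<forall>d\<in>Obj D. (act_triple (m d) t, s d) \<in> triple_equiv E \<phi> (omap S d)"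
      using u by blast
  qed
qed

text \<open>
  A functor \<open>T'\<close> to the category of elements consists of its projection \<open>T\<close> to \<open>E\<close> and elements \<open>y d\<close> of
  \<open>\<phi>(T d)\<close> that match. Under the co-Yoneda bijection \<open>y\<close> is a point of the limit of the colimits. A
  cocone for \<open>T'\<close> with vertex \<open>(e, p)\<close> is a cocone for \<open>T\<close> with vertex \<open>e\<close> such that its triple is sent
  to \<open>y\<close> by the comparison map. Surjectivity at \<open>y\<close> thus gives a cocone, and injectivity at \<open>y\<close> gives
  zig-zags: a chain of generating steps that starts at a cocone for \<open>T'\<close> consists of morphisms of
  such cocones.
\<close>

lemma (in weight) preserves_representables_imp_connected_cocones:
  assumes D: "small_category D" and T': "is_functor D El T'"
    and pres: "preserves_wlim (fun_cat E SET) SET (star E \<phi>) D const1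
      (representables E (comp_fctr elements_proj T'))"
  shows "nonempty_cat (cocone_cat D El T') \<and> connected_cat (cocone_cat D El T')"
proof -
  define T where "T = comp_fctr elements_proj T'"
  have T_simps: "omap T d = fst_code (omap T' d)" "amap T d d' f = amap T' d d' f" for d d' f
    by (simp_all add: T_def)
  define y where "y d = snd_code (omap T' d)" for d
  have Td: "omap T d \<in> Obj E" "y d \<in> omap \<phi> (omap T d)" if "d \<in> Obj D" for d
    using Obj_elementsD[OF functor_omap[OF T' that]] by (simp_all add: T_simps y_def)
  have Tf: "amap T d d' f \<in> Hom E (omap T d) (omap T d')" "amap \<phi> (omap T d') (omap T d) (amap T d d' f) (y d') = y d"
    if "d \<in> Obj D" "d' \<in> Obj D" "f \<in> Hom D d d'" for d d' f
    using functor_amap[OF T' that] by (simp_all add: T_simps y_def)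
  have T: "is_functor D E T"
    unfolding is_functor_def using Td Tf functor_Ident[OF T'] functor_Comp[OF T'] by (simp add: T_simps)
  interpret weighted_diagram D E "representables E T" \<phi>
    by unfold_locales (use D small_E functor_representables[OF D small_E T] in auto)
  obtain L m where lim: "is_lim (fun_cat E SET) D (representables E T) L m" using ex_lim by blast
  then interpret cocone_limit E \<phi> D T L m by unfold_locales (use D T in auto)
  have comm: "limit_commutes E \<phi> D (representables E T) L m"
    using pres lim unfolding T_def[symmetric] preserves_iff_commutes by blast
  let ?C = "cocone_cat D El T'"
  have mem: "(pair_code e p, cocone e z) \<in> Obj ?C \<longleftrightarrow> (\<forall>d\<in>Obj D. amap \<phi> e (omap T d) (m d e z) p = y d)"
    if "(e, p, z) \<in> triples E \<phi> L" for e p z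
    using that cocone_in[of e z] by (auto simp: mem_cocone_cat T_simps y_def cocone_def PiE_iff)
  have ex: "\<exists>z. (e, p, z) \<in> triples E \<phi> L \<and> c = cocone e z" if "(pair_code e p, c) \<in> Obj ?C" for e p c
  proof -
    have "(e, c) \<in> Obj (cocone_cat D E T)" using that by (auto simp: mem_cocone_cat T_simps)
    then show ?thesis using that cocone_surj[of e c] by (auto simp: mem_cocone_cat)
  qed
  have "nonempty_cat ?C"
  proof -
    \<comment> \<open>The triple that represents \<open>y d\<close> under the co-Yoneda bijection.\<close>
    let ?s = "\<lambda>d. (omap T d, y d, Ident E (omap T d))"
    have "\<forall>d\<in>Obj D. ?s d \<in> triples E \<phi> (omap (representables E T) d)"
      using Td Ident_in_Hom[OF E_category] by simp
    moreover have "\<forall>d\<in>Obj D. \<forall>d'\<in>Obj D. \<forall>f\<in>Hom D d d'.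
        (act_triple (amap (representables E T) d' d f) (?s d'), ?s d) \<in> triple_equiv E \<phi> (omap (representables E T) d)"
      using Td Tf Ident_in_Hom[OF E_category] Comp_Ident_left[OF E_category] presheaf_Ident[OF E_category \<phi>]
      by (simp add: representable_equiv_iff)
    ultimately obtain t where t: "t \<in> triples E \<phi> L"
      "\<forall>d\<in>Obj D. (act_triple (m d) t, ?s d) \<in> triple_equiv E \<phi> (omap (representables E T) d)"
      using comm[unfolded limit_commutes_def, THEN conjunct2, THEN spec, of ?s] by blast
    obtain e p z where t': "t = (e, p, z)" by (metis prod_cases3)
    have "amap \<phi> e (omap T d) (m d e z) p = y d" if d: "d \<in> Obj D" for d
    proof -
      have "((e, p, m d e z), ?s d) \<in> triple_equiv E \<phi> (omap (yoneda E) (omap T d))"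
        using t(2) d by (simp add: t')
      then show ?thesis
        using t(1) t' Td[OF d] leg_in_Hom[OF d] Ident_in_Hom[OF E_category] presheaf_Ident[OF E_category \<phi>]
        by (simp add: representable_equiv_iff)
    qed
    then show ?thesis using mem t(1) t' unfolding nonempty_cat_def by blast
  qed
  moreover have "connected_cat ?C"
    unfolding connected_cat_def
  proof (intro ballI)
    let ?R = "{(a, b). a \<in> Obj ?C \<and> b \<in> Obj ?C \<and> (Hom ?C a b \<noteq> {} \<or> Hom ?C b a \<noteq> {})}"
    let ?K = "\<lambda>(e, p, z). (pair_code e p, cocone e z)"
    have move: "(?K t \<in> Obj ?C \<longleftrightarrow> ?K t' \<in> Obj ?C) \<and> Hom ?C (?K t) (?K t') \<noteq> {}"
      if st: "(t, t') \<in> triple_step E \<phi> L" for t t'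
    proof -
      obtain e e' f p z where *: "t = (e, amap \<phi> e' e f p, z)" "t' = (e', p, amap L e e' f z)"
        "e \<in> Obj E" "e' \<in> Obj E" "f \<in> Hom E e e'" "p \<in> omap \<phi> e'" "z \<in> omap L e"
        using st by (rule triple_stepE)
      have "f \<in> Hom ?C (?K t) (?K t')"
        using * leg_natural[OF _ *(3-5,7)] by (simp add: Hom_cocone_cat cocone_def T_simps)
      moreover have "amap \<phi> e (omap T d) (m d e z) (amap \<phi> e' e f p) =
          amap \<phi> e' (omap T d) (m d e' (amap L e e' f z)) p" if d: "d \<in> Obj D" for d
        using presheaf_Comp[OF E_category \<phi> Td(1)[OF d] *(3,4) leg_in_Hom[OF d *(3,7)] *(5,6)]
          leg_natural[OF d *(3-5,7)] by simp
      then have "?K t \<in> Obj ?C \<longleftrightarrow> ?K t' \<in> Obj ?C"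
        using mem step_triples[OF L st] *(1,2) by simp
      ultimately show ?thesis by blast
    qed
    fix x x' assume x: "x \<in> Obj ?C" "x' \<in> Obj ?C"
    obtain e p z where t: "(e, p, z) \<in> triples E \<phi> L" "x = ?K (e, p, z)"
    proof -
      obtain b c where "x = (b, c)" by fastforce
      moreover then obtain e p where "b = pair_code e p" using x(1) by (auto simp: mem_cocone_cat elim!: Obj_elementsE)
      ultimately show ?thesis using ex[of e p c] x(1) that by auto
    qed
    obtain e' p' z' where t': "(e', p', z') \<in> triples E \<phi> L" "x' = ?K (e', p', z')"
    proof -
      obtain b c where "x' = (b, c)" by fastforce
      moreover then obtain e p where "b = pair_code e p" using x(2) by (auto simp: mem_cocone_cat elim!: Obj_elementsE)
      ultimately show ?thesis using ex[of e p c] x(2) that by auto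
    qed
    have "(act_triple (m d) (e, p, z), act_triple (m d) (e', p', z'))
        \<in> triple_equiv E \<phi> (omap (representables E T) d)" if d: "d \<in> Obj D" for d
    proof -
      have "amap \<phi> e (omap T d) (m d e z) p = y d" "amap \<phi> e' (omap T d) (m d e' z') p' = y d"
        using mem[OF t(1)] mem[OF t'(1)] x d t(2) t'(2) by auto
      then show ?thesis using t(1) t'(1) Td[OF d] leg_in_Hom[OF d] by (simp add: representable_equiv_iff)
    qed
    then have "((e, p, z), (e', p', z')) \<in> triple_equiv E \<phi> L"
      using comm t(1) t'(1) unfolding limit_commutes_def by blast
    then have "(e', p', z') \<in> {t. ?K t \<in> Obj ?C \<and> (x, ?K t) \<in> ?R\<^sup>*}"
      unfolding triple_equiv_def
    proof (induction rule: rtrancl_induct)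
      case base
      then show ?case using x(1) t(2) by simp
    next
      case (step t1 t2)
      have "?K t2 \<in> Obj ?C" "(?K t1, ?K t2) \<in> ?R"
        using step.hyps(2) step.IH move[of t1 t2] move[of t2 t1] by auto
      then show ?case using step.IH by (auto intro: rtrancl_into_rtrancl)
    qed
    then show "(x, x') \<in> ?R\<^sup>*" unfolding t'(2) by simp
  qed
  ultimately show ?thesis ..
qed


section \<open>Soundness and filteredness\<close>

theorem proposition3p5:
  fixes DD :: "('u::universe, 'u) cat set"
  assumes "\<forall>C\<in>DD. small_category C"
  shows "sound (conical_weights DD) \<longleftrightarrow>
    (\<forall>E :: ('u, 'u) cat. small_category E \<longrightarrow>
      (\<forall>D T. op_cat D \<in> DD \<longrightarrow> is_functor D E T \<longrightarrow>
        nonempty_cat (cocone_cat D E T) \<and> connected_cat (cocone_cat D E T)) \<longrightarrow>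
      filtered DD E)"
proof -
  have small_D: "small_category D" if "op_cat D \<in> DD" for D
    using assms that small_category_op by blast
  show ?thesis
  proof (intro iffI allI impI)
    fix E :: "('u, 'u) cat"
    assume sound: "sound (conical_weights DD)" and E: "small_category E"
      and cocones: "\<forall>D T. op_cat D \<in> DD \<longrightarrow> is_functor D E T \<longrightarrow>
        nonempty_cat (cocone_cat D E T) \<and> connected_cat (cocone_cat D E T)"
    have "is_weight (E, const1)" using weight_const1[OF E] by (simp add: weight_def)
    moreover have "flat_on_representables (conical_weights DD) (E, const1)"
      unfolding flat_on_representables_def conical_weights_def
      using cocones small_D connected_cocones_preserves_representables[OF E] by auto
    ultimately show "filtered DD E"
      using sound unfolding sound_def filtered_iff_flat by blast
  next
    assume filt: "\<forall>E :: ('u, 'u) cat. small_category E \<longrightarrow>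
      (\<forall>D T. op_cat D \<in> DD \<longrightarrow> is_functor D E T \<longrightarrow>
        nonempty_cat (cocone_cat D E T) \<and> connected_cat (cocone_cat D E T)) \<longrightarrow> filtered DD E"
    show "sound (conical_weights DD)"
      unfolding sound_def
    proof (intro allI impI)
      fix w :: "'u weight"
      assume w: "is_weight w" and flat: "flat_on_representables (conical_weights DD) w"
      obtain E \<phi> where [simp]: "w = (E, \<phi>)" by fastforce
      interpret weight E \<phi> by unfold_locales (use w in simp)
      have proj: "is_functor D E (comp_fctr elements_proj T)" if T: "is_functor D El T" for D T
        unfolding is_functor_def
        using Obj_elementsD(1)[OF functor_omap[OF T]] functor_amap[OF T] functor_Ident[OF T] functor_Comp[OF T]
        by simp
      have "nonempty_cat (cocone_cat D El T) \<and> connected_cat (cocone_cat D El T)"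
        if D: "op_cat D \<in> DD" and T: "is_functor D El T" for D T
        using flat D proj[OF T] unfolding flat_on_representables_def conical_weights_def
        by (intro preserves_representables_imp_connected_cocones[OF small_D[OF D] T]) auto
      then have "filtered DD El" using filt small_elements by blast
      then have pres: "preserves_wlim (fun_cat El SET) SET (star El const1) D const1 S'"
        if "op_cat D \<in> DD" "is_functor (op_cat D) (fun_cat El SET) S'" for D S'
        using that unfolding filtered_iff_flat flat_def conical_weights_def by auto
      show "flat (conical_weights DD) w"
        unfolding flat_def conical_weights_def
      proof (clarsimp)
        fix D and S :: "('u, ('u, 'u set, 'u, 'u \<Rightarrow> 'u) fctr, 'u, 'u \<Rightarrow> 'u \<Rightarrow> 'u) fctr"
        assume D_in: "op_cat D \<in> DD" and S: "is_functor (op_cat D) (fun_cat E SET) S"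
        interpret weighted_diagram D E S \<phi>
          by unfold_locales (use small_D[OF D_in] small_E S in auto)
        show "preserves_wlim (fun_cat E SET) SET (star E \<phi>) D const1 S"
          using pres[OF D_in] by (rule elements_preserves_imp_preserves)
      qed
    qed
  qed
qed

end
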